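(* Let $G$ be a compact Lie group, $\mathbb{V}$ a finite-dimensional real orthogonal $G$-representation, $\Omega\subset\mathbb{V}$ an open $G$-invariant subset, and $\varphi:\Omega\times\mathbb{R}\to\mathbb{R}$ a map of class $C^2$ with $\varphi(gv,\rho)=\varphi(v,\rho)$ for all $g\in G$, $(v,\rho)\in\Omega\times\mathbb{R}$. Let $w:\mathbb{R}\to\Omega$ be a continuous map with $\nabla_v\varphi(w(\rho),\rho)=0$ for all $\rho\in\mathbb{R}$, and let $\mathcal{F}=\bigcup_{\rho\in\mathbb{R}}G(w(\rho))\times\{\rho\}$. If $\rho_0\in\mathbb{R}$ is a parameter of local bifurcation, i.e. $\rho_0\in\mathcal{BIF}$, then $$\dim\ker\nabla_v^2\varphi(w(\rho_0),\rho_0)>\dim G(w(\rho_0)).$$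
   Context: $G(v)=\{gv:g\in G\}$ is the $G$-orbit of $v$. $\nabla_v\varphi$ and $\nabla_v^2\varphi$ are the gradient and Hessian with respect to the first variable. A parameter $\rho_0\in\mathbb{R}$ is a parameter of local bifurcation if the point $(w(\rho_0),\rho_0)$ is an accumulation point of the set $\{(v,\rho)\in(\Omega\times\mathbb{R})\setminus\mathcal{F}:\nabla_v\varphi(v,\rho)=0\}$; $\mathcal{BIF}$ denotes the set of all parameters of local bifurcation. *)

theory Defs
  imports "HOL-Analysis.Analysis" "HOL-Algebra.Group_Action"
begin

section \<open>Maps of class \<open>C\<^sup>k\<close>\<close>

text \<open>
  \<open>S\<close> is meant to be a relatively open subset of the linear subspace \<open>E\<close>; the derivative within
  \<open>S\<close> is then uniquely determined along \<open>E\<close>, and only these directions are used. For \<open>E = UNIV\<close>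
  this is the usual notion on open sets. The subspace is needed so that manifolds of dimension 0
  can be modelled, because every type of class \<open>euclidean_space\<close> has positive dimension.
\<close>

primrec Ck_on :: "nat \<Rightarrow> 'a::euclidean_space set \<Rightarrow> 'a set \<Rightarrow> ('a \<Rightarrow> 'b::real_normed_vector) \<Rightarrow> bool"
  where
    "Ck_on 0 E S f \<longleftrightarrow> continuous_on S f"
  | "Ck_on (Suc k) E S f \<longleftrightarrow>
       (\<forall>x\<in>S. f differentiable (at x within S)) \<and>
       (\<forall>u\<in>E. Ck_on k E S (\<lambda>x. frechet_derivative f (at x within S) u))"

definition smooth_on :: "'a::euclidean_space set \<Rightarrow> 'a set \<Rightarrow> ('a \<Rightarrow> 'b::real_normed_vector) \<Rightarrow> bool"
  where "smooth_on E S f \<longleftrightarrow> (\<forall>k. Ck_on k E S f)"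


section \<open>Smooth manifolds and Lie groups\<close>

text \<open>
  A chart is a pair \<open>(U, c)\<close> of its domain and its coordinate map; the inverse coordinate map is
  \<open>inv_into U c\<close>. The model space is the linear subspace \<open>E\<close>, whose dimension is the dimension
  of the manifold.
\<close>

type_synonym ('m, 'e) atlas = "('m set \<times> ('m \<Rightarrow> 'e)) set"

definition second_countable :: "'m topology \<Rightarrow> bool"
  where "second_countable X \<longleftrightarrow>
    (\<exists>B. countable B \<and> (\<forall>V\<in>B. openin X V) \<and>
         (\<forall>U x. openin X U \<and> x \<in> U \<longrightarrow> (\<exists>V\<in>B. x \<in> V \<and> V \<subseteq> U)))"

definition smooth_manifold :: "'e::euclidean_space set \<Rightarrow> 'm topology \<Rightarrow> ('m, 'e) atlas \<Rightarrow> bool"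
  where "smooth_manifold E X A \<longleftrightarrow>
    subspace E \<and> Hausdorff_space X \<and> second_countable X \<and>
    (\<Union>(U, c)\<in>A. U) = topspace X \<and>
    (\<forall>(U, c)\<in>A. openin X U \<and> openin (top_of_set E) (c ` U) \<and>
       homeomorphic_map (subtopology X U) (top_of_set (c ` U)) c) \<and>
    (\<forall>(U, c)\<in>A. \<forall>(V, d)\<in>A. smooth_on E (c ` (U \<inter> V)) (d \<circ> inv_into U c))"

definition smooth_map ::
    "'e::euclidean_space set \<Rightarrow> 'm topology \<Rightarrow> ('m, 'e) atlas \<Rightarrow>
     'n topology \<Rightarrow> ('n, 'f::euclidean_space) atlas \<Rightarrow> ('m \<Rightarrow> 'n) \<Rightarrow> bool"
  where "smooth_map E X A Y B f \<longleftrightarrow>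
    continuous_map X Y f \<and>
    (\<forall>(U, c)\<in>A. \<forall>(V, d)\<in>B.
       smooth_on E {x \<in> c ` U. f (inv_into U c x) \<in> V} (d \<circ> f \<circ> inv_into U c))"

definition prod_atlas :: "('m, 'e) atlas \<Rightarrow> ('n, 'f) atlas \<Rightarrow> ('m \<times> 'n, 'e \<times> 'f) atlas"
  where "prod_atlas A B = {(U \<times> V, map_prod c d) |U c V d. (U, c) \<in> A \<and> (V, d) \<in> B}"

locale lie_group = group G
  for G :: "('g, 'r) monoid_scheme" (structure)
    and X :: "'g topology"
    and E :: "'e::euclidean_space set"
    and A :: "('g, 'e) atlas" +
  assumes topspace_carrier: "topspace X = carrier G"
    and manifold: "smooth_manifold E X A"
    and smooth_mult:
      "smooth_map (E \<times> E) (prod_topology X X) (prod_atlas A A) X A (\<lambda>(g, h). g \<otimes> h)"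
    and smooth_inv: "smooth_map E X A X A (\<lambda>g. inv g)"

locale compact_lie_group = lie_group +
  assumes compact: "compact_space X"


section \<open>Orthogonal representations\<close>

text \<open>
  Continuity of the action map is equivalent to continuity of the homomorphism into the
  orthogonal group, because the representation space is finite-dimensional.
\<close>

locale orthogonal_representation = group_action G UNIV act
  for G :: "('g, 'r) monoid_scheme" (structure)
    and X :: "'g topology"
    and act :: "'g \<Rightarrow> 'v::euclidean_space \<Rightarrow> 'v" +
  assumes orthogonal: "g \<in> carrier G \<Longrightarrow> orthogonal_transformation (act g)"
    and continuous: "continuous_map (prod_topology X euclidean) euclidean (\<lambda>(g, v). act g v)"


section \<open>Dimension of a manifold embedded in a Euclidean space\<close>

text \<open>
  An orbit of a compact Lie group is a submanifold, and its dimension is that of the underlying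
  topological manifold: the \<open>k\<close> for which it is locally homeomorphic to open subsets of a
  \<open>k\<close>-dimensional linear space. By invariance of dimension there is at most one such \<open>k\<close> for
  a nonempty set. Only subspaces of the ambient space are used as model spaces, which is no
  restriction, because a subset of the ambient space cannot have larger dimension.
\<close>

definition locally_euclidean :: "nat \<Rightarrow> 'v::euclidean_space set \<Rightarrow> bool"
  where "locally_euclidean k M \<longleftrightarrow>
    (\<forall>x\<in>M. \<exists>U. openin (top_of_set M) U \<and> x \<in> U \<and>
       (\<exists>(L :: 'v set) W. subspace L \<and> dim L = k \<and> openin (top_of_set L) W \<and> U homeomorphic W))"

definition manifold_dim :: "'v::euclidean_space set \<Rightarrow> nat"
  where "manifold_dim M = (THE k. locally_euclidean k M)"


section \<open>Gradient and Hessian with respect to the first variable\<close>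

definition gradient :: "('v::euclidean_space \<Rightarrow> real) \<Rightarrow> 'v \<Rightarrow> 'v"
  where "gradient f x = (THE D. GDERIV f x :> D)"

definition grad_v :: "('v::euclidean_space \<times> real \<Rightarrow> real) \<Rightarrow> 'v \<Rightarrow> real \<Rightarrow> 'v"
  where "grad_v \<phi> v \<rho> = gradient (\<lambda>u. \<phi> (u, \<rho>)) v"

definition hess_v :: "('v::euclidean_space \<times> real \<Rightarrow> real) \<Rightarrow> 'v \<Rightarrow> real \<Rightarrow> 'v \<Rightarrow> 'v"
  where "hess_v \<phi> v \<rho> = frechet_derivative (\<lambda>u. grad_v \<phi> u \<rho>) (at v)"


section \<open>Local bifurcation\<close>

definition trivial_family ::
    "('g, 'r) monoid_scheme \<Rightarrow> ('g \<Rightarrow> 'v \<Rightarrow> 'v) \<Rightarrow> (real \<Rightarrow> 'v) \<Rightarrow> ('v \<times> real) set"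
  where "trivial_family G act w = (\<Union>\<rho>. orbit G act (w \<rho>) \<times> {\<rho>})"

definition BIF ::
    "('g, 'r) monoid_scheme \<Rightarrow> ('g \<Rightarrow> 'v \<Rightarrow> 'v) \<Rightarrow> 'v::euclidean_space set \<Rightarrow>
     ('v \<times> real \<Rightarrow> real) \<Rightarrow> (real \<Rightarrow> 'v) \<Rightarrow> real set"
  where "BIF G act \<Omega> \<phi> w =
    {\<rho>0. (w \<rho>0, \<rho>0) islimpt
       {(v, \<rho>). (v, \<rho>) \<in> \<Omega> \<times> UNIV - trivial_family G act w \<and> grad_v \<phi> v \<rho> = 0}}"

end

theory Submission
  imports Defs
begin

text \<open>
  The image \<open>K\<close> of the group in the orthogonal group is compact, and only \<open>K\<close> matters. The matrices
  \<open>A\<close> with \<open>exp (t A) \<in> K\<close> for all \<open>t\<close> form a linear space, and \<open>T = {A w}\<close> is the tangent space of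
  the orbit of \<open>w\<close>: every limit of normalized secants at \<open>w\<close> lies in \<open>T\<close>, so the orthogonal
  projection onto \<open>T\<close> is a chart near \<open>w\<close>, and the orbit has dimension \<open>dim T\<close>. Since the gradient
  vanishes along the orbit, \<open>T\<close> is contained in the kernel of the Hessian.

  Let \<open>(v\<^sub>n, \<rho>\<^sub>n)\<close> be bifurcating critical points. Moving \<open>v\<^sub>n\<close> and \<open>w(\<rho>\<^sub>n)\<close> by the group as close as
  possible to \<open>w(\<rho>\<^sub>0)\<close> puts both into the normal slice. They stay critical and distinct, so a
  limit of their normalized differences is a unit vector in the kernel of the Hessian that is
  orthogonal to \<open>T\<close>. Hence the kernel is strictly larger than \<open>T\<close>.
\<close>

section \<open>The Banach algebra of endomorphisms\<close>

text \<open>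
  A copy of the bounded operators on \<open>'a\<close>, because a type class cannot be instantiated only for the
  diagonal instances \<open>('a, 'a) blinfun\<close>.
\<close>

typedef (overloaded) ('a::euclidean_space) endo = "UNIV :: ('a \<Rightarrow>\<^sub>L 'a) set"
  morphisms blinfun_of_endo endo_of_blinfun ..

setup_lifting type_definition_endo

instantiation endo :: (euclidean_space) real_normed_algebra_1
begin

lift_definition norm_endo :: "'a endo \<Rightarrow> real" is norm .
lift_definition minus_endo :: "'a endo \<Rightarrow> 'a endo \<Rightarrow> 'a endo" is minus .
lift_definition uminus_endo :: "'a endo \<Rightarrow> 'a endo" is uminus .
lift_definition zero_endo :: "'a endo" is 0 .
lift_definition plus_endo :: "'a endo \<Rightarrow> 'a endo \<Rightarrow> 'a endo" is plus .
lift_definition scaleR_endo :: "real \<Rightarrow> 'a endo \<Rightarrow> 'a endo" is scaleR .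
lift_definition one_endo :: "'a endo" is id_blinfun .
lift_definition times_endo :: "'a endo \<Rightarrow> 'a endo \<Rightarrow> 'a endo" is blinfun_compose .

definition dist_endo :: "'a endo \<Rightarrow> 'a endo \<Rightarrow> real"
  where "dist_endo a b = norm (a - b)"

definition
  "(uniformity :: ('a endo \<times> 'a endo) filter) = (INF e\<in>{0 <..}. principal {(x, y). dist x y < e})"

definition open_endo :: "'a endo set \<Rightarrow> bool"
  where "open_endo S = (\<forall>x\<in>S. \<forall>\<^sub>F (x', y) in uniformity. x' = x \<longrightarrow> y \<in> S)"

definition sgn_endo :: "'a endo \<Rightarrow> 'a endo"
  where "sgn_endo x = scaleR (inverse (norm x)) x"

instance
proof
  fix x y z :: "'a endo" and a b :: real
  show "x + y + z = x + (y + z)" "x + y = y + x" "0 + x = x" "- x + x = 0" "x - y = x + - y"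
    "a *\<^sub>R (x + y) = a *\<^sub>R x + a *\<^sub>R y" "(a + b) *\<^sub>R x = a *\<^sub>R x + b *\<^sub>R x"
    "a *\<^sub>R b *\<^sub>R x = (a * b) *\<^sub>R x" "1 *\<^sub>R x = x"
    by (transfer; simp add: algebra_simps)+
  show "dist x y = norm (x - y)" "sgn x = inverse (norm x) *\<^sub>R x"
    by (simp_all add: dist_endo_def sgn_endo_def)
  show "(uniformity :: ('a endo \<times> 'a endo) filter) = (INF e\<in>{0 <..}. principal {(x, y). dist x y < e})"
    by (rule uniformity_endo_def)
  show "open U = (\<forall>x\<in>U. \<forall>\<^sub>F (x', y) in uniformity. x' = x \<longrightarrow> y \<in> U)" for U :: "'a endo set"
    by (rule open_endo_def)
  show "(norm x = 0) = (x = 0)" "norm (a *\<^sub>R x) = \<bar>a\<bar> * norm x"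
    by (transfer; simp)+
  show "norm (x + y) \<le> norm x + norm y"
    by transfer (rule norm_triangle_ineq)
  show "x * y * z = x * (y * z)" "(x + y) * z = x * z + y * z" "x * (y + z) = x * y + x * z"
    "1 * x = x" "x * 1 = x" "a *\<^sub>R x * y = a *\<^sub>R (x * y)" "x * a *\<^sub>R y = a *\<^sub>R (x * y)"
    by (transfer; auto intro!: blinfun_eqI simp: blinfun.bilinear_simps)+
  show "norm (x * y) \<le> norm x * norm y"
    by transfer (rule norm_blinfun_compose)
  show "norm (1 :: 'a endo) = 1"
    by transfer simp
  moreover have "norm (0 :: 'a endo) = 0"
    by transfer simp
  ultimately show "(0 :: 'a endo) \<noteq> 1"
    by auto
qed

end

lemma bounded_linear_blinfun_of_endo: "bounded_linear blinfun_of_endo"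
  by (rule bounded_linear_intro[where K = 1])
    (simp_all add: plus_endo.rep_eq scaleR_endo.rep_eq norm_endo.rep_eq)

lemma bounded_linear_endo_of_blinfun: "bounded_linear endo_of_blinfun"
  by (rule bounded_linear_intro[where K = 1])
    (simp_all add: plus_endo.abs_eq scaleR_endo.abs_eq norm_endo.abs_eq)

instance endo :: (euclidean_space) banach
proof
  fix X :: "nat \<Rightarrow> 'a endo"
  assume "Cauchy X"
  then have "Cauchy (\<lambda>n. blinfun_of_endo (X n))"
    by (rule bounded_linear.Cauchy[OF bounded_linear_blinfun_of_endo])
  then obtain l where "(\<lambda>n. blinfun_of_endo (X n)) \<longlonglongrightarrow> l"
    using Cauchy_convergent convergent_def by blast
  from bounded_linear.tendsto[OF bounded_linear_endo_of_blinfun this] show "convergent X"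
    by (auto simp: blinfun_of_endo_inverse convergent_def)
qed

instance endo :: (euclidean_space) heine_borel
proof
  fix f :: "nat \<Rightarrow> 'a endo"
  assume "bounded (range f)"
  then have "bounded (range (\<lambda>n. blinfun_of_endo (f n)))"
    using bounded_linear_image[OF _ bounded_linear_blinfun_of_endo] by (metis image_image)
  from bounded_imp_convergent_subsequence[OF this]
  obtain l r where "strict_mono r" "((\<lambda>n. blinfun_of_endo (f n)) \<circ> r) \<longlonglongrightarrow> l"
    by blast
  moreover from bounded_linear.tendsto[OF bounded_linear_endo_of_blinfun this(2)]
  have "(f \<circ> r) \<longlonglongrightarrow> endo_of_blinfun l"
    by (simp add: o_def blinfun_of_endo_inverse)
  ultimately show "\<exists>l r. strict_mono r \<and> (f \<circ> r) \<longlonglongrightarrow> l"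
    by blast
qed

lift_definition eapp :: "'a::euclidean_space endo \<Rightarrow> 'a \<Rightarrow> 'a" is blinfun_apply .

lemma bounded_bilinear_eapp: "bounded_bilinear eapp"
  unfolding eapp.rep_eq
  by (rule bounded_bilinear.comp1[OF bounded_bilinear_blinfun_apply bounded_linear_blinfun_of_endo])

interpretation eapp: bounded_bilinear eapp
  by (rule bounded_bilinear_eapp)

lemmas eapp_tendsto [tendsto_intros] = eapp.tendsto
lemmas eapp_continuous_on [continuous_intros] = eapp.continuous_on

lemma eapp_mult [simp]: "eapp (a * b) v = eapp a (eapp b v)"
  by transfer simp

lemma eapp_one [simp]: "eapp 1 v = v"
  by transfer simp

lemma eapp_eqI: "(\<And>v. eapp a v = eapp b v) \<Longrightarrow> a = b"
  by transfer (rule blinfun_eqI)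

lemma norm_eapp: "norm (eapp a v) \<le> norm a * norm v"
  by transfer (rule norm_blinfun)

lemma norm_endo_bound: "0 \<le> b \<Longrightarrow> (\<And>v. norm (eapp a v) \<le> b * norm v) \<Longrightarrow> norm a \<le> b"
  by transfer (rule norm_blinfun_bound)

definition endo_of :: "('a::euclidean_space \<Rightarrow> 'a) \<Rightarrow> 'a endo"
  where "endo_of f = endo_of_blinfun (Blinfun f)"

lemma eapp_endo_of: "bounded_linear f \<Longrightarrow> eapp (endo_of f) = f"
  by (simp add: endo_of_def eapp.rep_eq endo_of_blinfun_inverse bounded_linear_Blinfun_apply)

section \<open>Powers and exponentials in a Banach algebra\<close>

lemma exp_of_nat_scaleR:
  fixes x :: "'a::{real_normed_algebra_1, banach}"
  shows "exp (of_nat n *\<^sub>R x) = exp x ^ n"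
proof (induction n)
  case (Suc n)
  have "exp (of_nat (Suc n) *\<^sub>R x) = exp (x + of_nat n *\<^sub>R x)"
    by (simp add: algebra_simps)
  also have "\<dots> = exp x * exp (of_nat n *\<^sub>R x)"
    by (rule exp_add_commuting) simp
  finally show ?case
    using Suc by simp
qed simp

text \<open>Telescoping from \<open>a ^ Suc m - b ^ Suc m = a * (a ^ m - b ^ m) + (a - b) * b ^
  m\<close>. The bounds are asymmetric because \<open>a\<close> will be a group element, of norm at
  most 1, and \<open>b\<close> an exponential, whose norm may slightly exceed 1.\<close>

lemma norm_power_diff:
  fixes a b :: "'a::real_normed_algebra_1"
  assumes "norm a \<le> 1" "norm b \<le> M" "1 \<le> M"
  shows "norm (a ^ m - b ^ m) \<le> of_nat m * norm (a - b) * M ^ m"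
proof (induction m)
  case (Suc m)
  have b: "norm (b ^ m) \<le> M ^ m"
    using norm_power_ineq[of b m] power_mono[OF assms(2), of m] by simp
  have "a ^ Suc m - b ^ Suc m = a * (a ^ m - b ^ m) + (a - b) * b ^ m"
    by (simp add: algebra_simps)
  also have "norm \<dots> \<le> norm a * norm (a ^ m - b ^ m) + norm (a - b) * norm (b ^ m)"
    by (intro norm_triangle_le add_mono norm_mult_ineq)
  also have "\<dots> \<le> norm (a ^ m - b ^ m) + norm (a - b) * M ^ m"
    using assms(1) b by (intro add_mono mult_left_mono mult_left_le_one_le) auto
  also have "\<dots> \<le> of_nat m * norm (a - b) * M ^ m + norm (a - b) * M ^ m"
    using Suc by simp
  also have "\<dots> = of_nat (Suc m) * norm (a - b) * M ^ m"
    by (simp add: algebra_simps)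
  also have "\<dots> \<le> of_nat (Suc m) * norm (a - b) * M ^ Suc m"
    using assms(3) by (intro mult_left_mono power_increasing) auto
  finally show ?case .
qed simp

section \<open>From linear maps to endomorphisms, continuously\<close>

lemma bounded_linear_orthogonal_transformation:
  fixes f :: "'v::euclidean_space \<Rightarrow> 'v"
  shows "orthogonal_transformation f \<Longrightarrow> bounded_linear f"
  by (intro linear_conv_bounded_linear[THEN iffD1] orthogonal_transformation_linear)

text \<open>Splitting into rank-one operators: an endomorphism depends linearly, hence continuously,
  on its finitely many values on the basis.\<close>

lemma endo_eq_sum:
  fixes f :: "'v::euclidean_space \<Rightarrow> 'v"
  assumes "bounded_linear f"
  shows "endo_of f = (\<Sum>i\<in>Basis. endo_of (\<lambda>v. (v \<bullet> i) *\<^sub>R f i))"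
proof (rule eapp_eqI)
  fix v
  have "eapp (\<Sum>i\<in>Basis. endo_of (\<lambda>v. (v \<bullet> i) *\<^sub>R f i)) v = (\<Sum>i\<in>Basis. (v \<bullet> i) *\<^sub>R f i)"
    by (simp add: eapp.sum_left eapp_endo_of bounded_linear_intros)
  also have "\<dots> = f v"
    using linear_sum[OF bounded_linear.linear[OF assms], of "\<lambda>i. (v \<bullet> i) *\<^sub>R i" Basis]
    by (simp add: linear_scale[OF bounded_linear.linear[OF assms]] euclidean_representation)
  finally show "eapp (endo_of f) v = eapp (\<Sum>i\<in>Basis. endo_of (\<lambda>v. (v \<bullet> i) *\<^sub>R f i)) v"
    by (simp add: eapp_endo_of assms)
qed

lemma continuous_endo_of_rank_one:
  fixes i :: "'v::euclidean_space"
  shows "continuous_on UNIV (\<lambda>b. endo_of (\<lambda>v. (v \<bullet> i) *\<^sub>R b))"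
proof -
  have eapp_rank_one: "eapp (endo_of (\<lambda>v. (v \<bullet> i) *\<^sub>R b)) v = (v \<bullet> i) *\<^sub>R b" for b v :: 'v
    by (subst eapp_endo_of) (intro bounded_linear_intros, rule refl)
  have "linear (\<lambda>b. endo_of (\<lambda>v. (v \<bullet> i) *\<^sub>R b))"
    by (intro linearI eapp_eqI)
      (simp_all only: eapp_rank_one eapp.add_left eapp.scaleR_left, simp_all add: algebra_simps)
  then show ?thesis
    by (intro linear_continuous_on) (simp add: linear_conv_bounded_linear)
qed

text \<open>In finite dimension pointwise continuity upgrades to continuity in the operator norm.
  This makes the image of the compact group compact.\<close>

lemma continuous_map_endo_of:
  fixes F :: "'g \<Rightarrow> 'v::euclidean_space \<Rightarrow> 'v"
  assumes "\<And>g. g \<in> topspace X \<Longrightarrow> bounded_linear (F g)"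
    and "\<And>v. continuous_map X euclidean (\<lambda>g. F g v)"
  shows "continuous_map X euclidean (\<lambda>g. endo_of (F g))"
proof -
  have "continuous_map X euclidean (\<lambda>g. endo_of (\<lambda>v. (v \<bullet> i) *\<^sub>R F g i))" for i
    using continuous_map_compose[OF assms(2)[of i], of euclidean "\<lambda>b. endo_of (\<lambda>v. (v \<bullet> i) *\<^sub>R b)"]
      continuous_endo_of_rank_one[of i] by (simp add: o_def)
  then have "continuous_map X euclidean (\<lambda>g. \<Sum>i\<in>Basis. endo_of (\<lambda>v. (v \<bullet> i) *\<^sub>R F g i))"
    by (intro continuous_map_sum) auto
  then show ?thesis
    by (rule continuous_map_eq) (simp add: endo_eq_sum[OF assms(1), symmetric])
qed

section \<open>Differentiability at 0 and continuity of the exponential\<close>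

lemma norm_exp_diff_linear:
  fixes h :: "'a::{real_normed_algebra_1, banach}"
  assumes "norm h \<le> 1"
  shows "norm (exp h - 1 - h) \<le> (norm h)\<^sup>2"
proof -
  have sum: "summable (\<lambda>n. norm h ^ (n + 2) /\<^sub>R fact (n + 2))"
    by (intro summable_ignore_initial_segment summable_exp_generic)
  \<comment> \<open>Termwise comparison with the series of the real exponential at
    \<open>norm h\<close>, whose tail \<open>exp_bound\<close> controls by the square.\<close>
  have "norm (\<Sum>n. h ^ (n + 2) /\<^sub>R fact (n + 2)) \<le> (\<Sum>n. norm h ^ (n + 2) /\<^sub>R fact (n + 2))"
  proof (rule norm_suminf_le)
    show "norm (h ^ (n + 2) /\<^sub>R fact (n + 2)) \<le> norm h ^ (n + 2) /\<^sub>R fact (n + 2)" for n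
      using norm_power_ineq[of h "n + 2"] by (simp add: mult_left_mono del: power_Suc fact_Suc)
  qed (rule sum)
  moreover have "exp h - 1 - h = (\<Sum>n. h ^ (n + 2) /\<^sub>R fact (n + 2))"
    by (subst exp_first_two_terms) simp
  moreover have "exp (norm h) - 1 - norm h = (\<Sum>n. norm h ^ (n + 2) /\<^sub>R fact (n + 2))"
    by (subst exp_first_two_terms) simp
  ultimately show ?thesis
    using exp_bound[of "norm h"] assms by simp
qed

text \<open>The chart construction differentiates the exponential of a vector-dependent argument, so
  a Frechet derivative is needed and not only one along a line; the quadratic remainder gives
  it.\<close>

lemma has_derivative_exp_0:
  "(exp has_derivative (\<lambda>h. h)) (at (0 :: 'a::{real_normed_algebra_1, banach}))"
proof -
  have "((\<lambda>h::'a. norm (exp h - 1 - h) / norm h) \<longlongrightarrow> 0) (at 0)"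
  proof (rule Lim_null_comparison)
    have "\<forall>\<^sub>F h::'a in at 0. norm h < 1"
      using eventually_at_ball[of 1 "0::'a" UNIV] by simp
    then show "\<forall>\<^sub>F h::'a in at 0. norm (norm (exp h - 1 - h) / norm h) \<le> norm h"
    proof eventually_elim
      case (elim h)
      then show ?case
        using norm_exp_diff_linear[of h]
        by (cases "h = 0") (simp_all add: divide_le_eq power2_eq_square)
    qed
    show "((\<lambda>h::'a. norm h) \<longlongrightarrow> 0) (at 0)"
      by (rule tendsto_norm_zero) (rule tendsto_ident_at)
  qed
  then show ?thesis
    by (simp add: has_derivative_at)
qed

text \<open>The Weierstrass test gives uniform convergence of the series on every closed ball, and
  each point is interior to such a ball.\<close>

lemma continuous_on_exp_algebra:
  "continuous_on UNIV (exp :: 'a::{real_normed_algebra_1, banach} \<Rightarrow> 'a)"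
proof -
  have cont: "continuous_on (cball 0 R) (exp :: 'a \<Rightarrow> 'a)" for R
  proof -
    have "uniform_limit (cball 0 R) (\<lambda>n x. \<Sum>i<n. x ^ i /\<^sub>R fact i) (\<lambda>x::'a. \<Sum>i. x ^ i /\<^sub>R fact i) sequentially"
    proof (rule Weierstrass_m_test)
      show "norm (x ^ i /\<^sub>R fact i) \<le> R ^ i /\<^sub>R fact i" if "x \<in> cball (0::'a) R" for i x
      proof -
        have "norm (x ^ i) \<le> R ^ i"
          using order_trans[OF norm_power_ineq power_mono[of "norm x" R i]] that by simp
        then show ?thesis
          by (simp add: mult_left_mono)
      qed
    qed (rule summable_exp_generic)
    then show ?thesis
      unfolding exp_def
      by (rule uniform_limit_theorem[rotated]) (auto intro!: always_eventually continuous_intros)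
  qed
  show ?thesis
    unfolding continuous_on_eq_continuous_at[OF open_UNIV]
  proof
    fix x :: 'a
    have "continuous_on (ball 0 (norm x + 1)) (exp :: 'a \<Rightarrow> 'a)"
      using cont[of "norm x + 1"] ball_subset_cball by (rule continuous_on_subset)
    then show "isCont exp x"
      by (rule continuous_on_interior) simp
  qed
qed

section \<open>Derivatives along null sequences, and extraction of limits\<close>

lemma has_vector_derivative_sequentially:
  assumes "(f has_vector_derivative d) (at 0)" "t \<longlonglongrightarrow> 0" "\<And>n. t n \<noteq> 0"
  shows "(\<lambda>n. (f (t n) - f 0) /\<^sub>R t n) \<longlonglongrightarrow> d"
proof -
  have "((\<lambda>h. norm (f (0 + h) - f 0 - h *\<^sub>R d) / norm h) \<longlongrightarrow> 0) (at 0)"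
    using assms(1) by (simp add: has_vector_derivative_def has_derivative_at)
  moreover have "filterlim t (at 0) sequentially"
    using assms by (simp add: filterlim_at)
  ultimately have "(\<lambda>n. norm (f (0 + t n) - f 0 - t n *\<^sub>R d) / norm (t n)) \<longlonglongrightarrow> 0"
    by (rule filterlim_compose)
  moreover have "norm (f (0 + t n) - f 0 - t n *\<^sub>R d) / norm (t n) =
      norm ((f (t n) - f 0) /\<^sub>R t n - d)" for n
  proof -
    have "(f (t n) - f 0) /\<^sub>R t n - d = (f (t n) - f 0 - t n *\<^sub>R d) /\<^sub>R t n"
      using assms(3)[of n] by (simp add: scaleR_diff_right)
    then show ?thesis by (simp add: divide_inverse_commute)
  qed
  ultimately have "(\<lambda>n. norm ((f (t n) - f 0) /\<^sub>R t n - d)) \<longlonglongrightarrow> 0"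
    by simp
  then show ?thesis
    by (rule LIM_zero_cancel[OF tendsto_norm_zero_cancel])
qed

lemma exp_quotient_sequentially:
  fixes A :: "'a::{real_normed_algebra_1, banach}"
  assumes "t \<longlonglongrightarrow> 0" "\<And>n. t n \<noteq> 0"
  shows "(\<lambda>n. (exp (t n *\<^sub>R A) - 1) /\<^sub>R t n) \<longlonglongrightarrow> A"
proof -
  have "((\<lambda>t. exp (t *\<^sub>R A)) has_vector_derivative A) (at 0)"
    using exp_scaleR_has_vector_derivative_right[of A 0 UNIV] by simp
  from has_vector_derivative_sequentially[OF this assms] show ?thesis
    by simp
qed

lemma compact_sequence:
  fixes x :: "nat \<Rightarrow> 'a::metric_space"
  assumes "compact S" "\<And>n. x n \<in> S"
  obtains l and r :: "nat \<Rightarrow> nat" where "l \<in> S" "strict_mono r" "(\<lambda>n. x (r n)) \<longlonglongrightarrow> l"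
  by (rule seq_compactE[OF compact_imp_seq_compact[OF assms(1)], of x])
    (use assms(2) in \<open>auto simp: o_def\<close>)

text \<open>Compactness of the unit sphere. The limiting unit directions below are produced this
  way.\<close>

lemma unit_sequence_limit:
  fixes x :: "nat \<Rightarrow> 'a::{real_normed_vector, heine_borel}"
  assumes "\<And>n. x n \<noteq> 0"
  obtains u and r :: "nat \<Rightarrow> nat" where "norm u = 1" "strict_mono r"
    "(\<lambda>n. x (r n) /\<^sub>R norm (x (r n))) \<longlonglongrightarrow> u"
proof -
  have "closed {x::'a. norm x = 1}"
    by (intro closed_Collect_eq continuous_intros)
  moreover have "bounded {x::'a. norm x = 1}"
    by (auto intro: boundedI)
  ultimately have "compact {x::'a. norm x = 1}"
    by (simp add: compact_eq_bounded_closed)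
  moreover have "x n /\<^sub>R norm (x n) \<in> {x. norm x = 1}" for n
    using assms[of n] by simp
  ultimately show thesis
    by (rule compact_sequence) (use that in auto)
qed

section \<open>The Lie algebra of a compact group of isometries\<close>

text \<open>A compact subgroup of the orthogonal group, as axioms on a set of endomorphisms.
  Inverses are postulated to exist in \<open>K\<close>, since the algebra carries no inverse
  operation.\<close>

locale compact_isometry_group =
  fixes K :: "'v::euclidean_space endo set"
  assumes compact: "compact K"
    and one: "1 \<in> K"
    and mult: "\<And>a b. a \<in> K \<Longrightarrow> b \<in> K \<Longrightarrow> a * b \<in> K"
    and inverse: "\<And>a. a \<in> K \<Longrightarrow> \<exists>b\<in>K. a * b = 1 \<and> b * a = 1"
    and isometry: "\<And>a v. a \<in> K \<Longrightarrow> norm (eapp a v) = norm v"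
begin

definition lie :: "'v endo set"
  where "lie = {A. \<forall>t. exp (t *\<^sub>R A) \<in> K}"

definition orb :: "'v \<Rightarrow> 'v set"
  where "orb v = (\<lambda>k. eapp k v) ` K"

definition tangent :: "'v \<Rightarrow> 'v set"
  where "tangent v = (\<lambda>A. eapp A v) ` lie"

lemma norm_le_one: "k \<in> K \<Longrightarrow> norm k \<le> 1"
  by (rule norm_endo_bound) (simp_all add: isometry)

lemma norm_mult_right_le:
  assumes "k \<in> K" shows "norm (a * k) \<le> norm a"
proof (rule norm_endo_bound)
  show "norm (eapp (a * k) v) \<le> norm a * norm v" for v
    using norm_eapp[of a "eapp k v"] assms by (simp add: isometry)
qed simp

text \<open>The inverse, also an isometry, gives the reverse estimate. Right translations therefore
  preserve distances, which is how representatives of orbit points are compared below.\<close>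

lemma norm_mult_right:
  assumes "k \<in> K" shows "norm (a * k) = norm a"
proof (rule antisym)
  obtain b where "b \<in> K" "k * b = 1"
    using inverse[OF assms] by blast
  then show "norm a \<le> norm (a * k)"
    using norm_mult_right_le[of b "a * k"] by (simp add: mult.assoc)
qed (rule norm_mult_right_le[OF assms])

lemma power_closed: "k \<in> K \<Longrightarrow> k ^ n \<in> K"
  by (induction n) (auto intro: one mult)

lemma limit_closed: "(\<And>n. x n \<in> K) \<Longrightarrow> x \<longlonglongrightarrow> l \<Longrightarrow> l \<in> K"
  by (rule closed_sequentially[OF compact_imp_closed[OF compact]])

lemma inverse_exp:
  assumes "exp a \<in> K" shows "exp (- a) \<in> K"
proof -
  obtain b where b: "b \<in> K" "b * exp a = 1"
    using inverse[OF assms] by blast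
  have "exp (- a) = b * exp a * exp (- a)"
    by (simp add: b)
  also have "\<dots> = b"
    by (simp add: mult.assoc exp_minus_inverse)
  finally show ?thesis
    using b by simp
qed

lemma lie_exp: "A \<in> lie \<Longrightarrow> exp (t *\<^sub>R A) \<in> K"
  by (simp add: lie_def)

text \<open>The powers \<open>k n ^ \<lfloor>s / t n\<rfloor>\<close> converge to \<open>exp (s A)\<close>.\<close>

lemma lie_limit:
  assumes k: "\<And>n. k n \<in> K" and t: "\<And>n. 0 < t n" "t \<longlonglongrightarrow> 0"
    and lim: "(\<lambda>n. (k n - 1) /\<^sub>R t n) \<longlonglongrightarrow> A"
  shows "A \<in> lie"
proof -
  have nonneg: "exp (s *\<^sub>R A) \<in> K" if "0 \<le> s" for s
  proof -
    define m where "m n = nat \<lfloor>s / t n\<rfloor>" for n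
    define e where "e n = exp (t n *\<^sub>R A)" for n
    have m: "real (m n) * t n \<le> s" "s - t n \<le> real (m n) * t n" for n
    proof -
      have "real (m n) = of_int \<lfloor>s / t n\<rfloor>"
        using that t(1)[of n] by (simp add: m_def)
      then have "real (m n) \<le> s / t n" "s / t n - 1 \<le> real (m n)"
        by linarith+
      then show "real (m n) * t n \<le> s" "s - t n \<le> real (m n) * t n"
        using t(1)[of n] by (simp_all add: field_simps)
    qed
    have mt: "(\<lambda>n. real (m n) * t n) \<longlonglongrightarrow> s"
    proof (rule tendsto_sandwich[OF always_eventually always_eventually])
      show "(\<lambda>n. s - t n) \<longlonglongrightarrow> s"
        using tendsto_diff[OF tendsto_const t(2), of s] by simp
      show "(\<lambda>n. s) \<longlonglongrightarrow> s"
        by simp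
    qed (use m in auto)
    have em: "e n ^ m n = exp ((real (m n) * t n) *\<^sub>R A)" for n
      by (simp add: e_def flip: exp_of_nat_scaleR)
    have "(\<lambda>n. e n ^ m n) \<longlonglongrightarrow> exp (s *\<^sub>R A)"
      unfolding em
      by (rule isCont_tendsto_compose[OF has_vector_derivative_continuous
            [OF exp_scaleR_has_vector_derivative_right] mt])
    moreover have "(\<lambda>n. k n ^ m n - e n ^ m n) \<longlonglongrightarrow> 0"
    proof (rule Lim_null_comparison[OF always_eventually], rule allI)
      fix n
      have "norm (k n ^ m n - e n ^ m n)
          \<le> real (m n) * norm (k n - e n) * exp (t n * norm A) ^ m n"
      proof (rule norm_power_diff)
        show "norm (e n) \<le> exp (t n * norm A)"
          using norm_exp[of "t n *\<^sub>R A"] t(1)[of n] by (simp add: e_def)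
        show "1 \<le> exp (t n * norm A)"
          using t(1)[of n] by simp
      qed (rule norm_le_one[OF k])
      also have "exp (t n * norm A) ^ m n = exp ((real (m n) * t n) * norm A)"
        by (simp add: mult.assoc flip: exp_of_nat_mult)
      \<comment> \<open>The powers are compared through difference quotients at 1:
        \<open>real (m n) * t n\<close> stays bounded, and both quotients tend to
        \<open>A\<close>.\<close>
      also have "real (m n) * norm (k n - e n) =
          (real (m n) * t n) * norm ((k n - 1) /\<^sub>R t n - (e n - 1) /\<^sub>R t n)"
      proof -
        have "(k n - 1) /\<^sub>R t n - (e n - 1) /\<^sub>R t n = (k n - e n) /\<^sub>R t n"
          by (simp flip: scaleR_diff_right)
        then show ?thesis
          using t(1)[of n] by (simp add: abs_of_pos)
      qed
      finally show "norm (k n ^ m n - e n ^ m n) \<le>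
          (real (m n) * t n) * norm ((k n - 1) /\<^sub>R t n - (e n - 1) /\<^sub>R t n)
            * exp ((real (m n) * t n) * norm A)" .
    next
      have "(\<lambda>n. (e n - 1) /\<^sub>R t n) \<longlonglongrightarrow> A"
        unfolding e_def using t by (intro exp_quotient_sequentially) (simp_all add: order_less_imp_not_eq2)
      then have "(\<lambda>n. (real (m n) * t n) * norm ((k n - 1) /\<^sub>R t n - (e n - 1) /\<^sub>R t n)
            * exp ((real (m n) * t n) * norm A)) \<longlonglongrightarrow> s * norm (A - A) * exp (s * norm A)"
        by (intro tendsto_intros mt lim)
      then show "(\<lambda>n. (real (m n) * t n) * norm ((k n - 1) /\<^sub>R t n - (e n - 1) /\<^sub>R t n)
            * exp ((real (m n) * t n) * norm A)) \<longlonglongrightarrow> 0"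
        by simp
    qed
    ultimately have "(\<lambda>n. k n ^ m n) \<longlonglongrightarrow> exp (s *\<^sub>R A)"
      using tendsto_add[of "\<lambda>n. k n ^ m n - e n ^ m n" 0 sequentially "\<lambda>n. e n ^ m n"] by simp
    then show ?thesis
      by (rule limit_closed[rotated]) (intro power_closed k)
  qed
  \<comment> \<open>Negative parameters follow by inversion in \<open>K\<close>.\<close>
  have "exp (s *\<^sub>R A) \<in> K" for s
  proof (cases "0 \<le> s")
    case False
    then show ?thesis
      using inverse_exp[OF nonneg[of "- s"]] by simp
  qed (rule nonneg)
  then show ?thesis
    by (simp add: lie_def)
qed

text \<open>For sums, the curve \<open>exp (s A) * exp (s B)\<close> stays in \<open>K\<close> and
  has derivative \<open>A + B\<close> at 0, so \<open>lie_limit\<close> applies to its values at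
  \<open>1 / (n + 1)\<close>.\<close>

lemma subspace_lie: "subspace lie"
  unfolding subspace_def
proof (intro conjI ballI allI)
  show "0 \<in> lie"
    by (simp add: lie_def one)
  show "c *\<^sub>R A \<in> lie" if "A \<in> lie" for c A
    using that by (simp add: lie_def)
  fix A B assume "A \<in> lie" "B \<in> lie"
  define t where "t n = inverse (real (Suc n))" for n
  have t: "t \<longlonglongrightarrow> 0" "\<And>n. 0 < t n"
    unfolding t_def by (rule LIMSEQ_inverse_real_of_nat) simp
  have "((\<lambda>s. exp (s *\<^sub>R A) * exp (s *\<^sub>R B)) has_vector_derivative A + B) (at 0)"
    using has_vector_derivative_mult[OF exp_scaleR_has_vector_derivative_right[of A 0 UNIV]
      exp_scaleR_has_vector_derivative_right[of B 0 UNIV]] by (simp add: add.commute)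
  from has_vector_derivative_sequentially[OF this t(1)]
  have "(\<lambda>n. (exp (t n *\<^sub>R A) * exp (t n *\<^sub>R B) - 1) /\<^sub>R t n) \<longlonglongrightarrow> A + B"
    using t(2) by (simp add: order_less_imp_not_eq2)
  then show "A + B \<in> lie"
    using t \<open>A \<in> lie\<close> \<open>B \<in> lie\<close>
    by - (rule lie_limit[of "\<lambda>n. exp (t n *\<^sub>R A) * exp (t n *\<^sub>R B)" t],
        auto intro: mult lie_exp)
qed

text \<open>The curve \<open>exp (t A) v\<close> has derivative \<open>exp (t A) (A v) = 0\<close>
  and is therefore constant.\<close>

lemma eapp_exp_fixes:
  assumes "eapp A v = 0"
  shows "eapp (exp (t *\<^sub>R A)) v = v"
proof -
  have "((\<lambda>t. eapp (exp (t *\<^sub>R A)) v) has_derivative (\<lambda>h. 0)) (at t within UNIV)" for t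
  proof -
    have "((\<lambda>t. eapp (exp (t *\<^sub>R A)) v) has_vector_derivative eapp (exp (t *\<^sub>R A) * A) v) (at t)"
      using bounded_linear.has_vector_derivative[OF eapp.bounded_linear_left
          exp_scaleR_has_vector_derivative_right] .
    then show ?thesis
      using assms by (simp add: has_vector_derivative_def eapp.zero_right)
  qed
  then have "(\<lambda>t. eapp (exp (t *\<^sub>R A)) v) t = (\<lambda>t. eapp (exp (t *\<^sub>R A)) v) 0"
    by (rule has_derivative_zero_unique[OF convex_UNIV]) auto
  then show ?thesis by simp
qed

end

section \<open>Orbits are manifolds\<close>

text \<open>The projection is the expansion in an orthonormal basis of \<open>T\<close>;
  orthogonality of the remainder extends from the basis to its span.\<close>

lemma orthogonal_projection_exists:
  fixes T :: "'a::euclidean_space set"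
  assumes "subspace T"
  obtains p where "bounded_linear p" "\<And>v. p v \<in> T" "\<And>v. v \<in> T \<Longrightarrow> p v = v"
    "\<And>v u. u \<in> T \<Longrightarrow> (v - p v) \<bullet> u = 0"
proof -
  obtain B where B: "B \<subseteq> T" "pairwise orthogonal B" "\<And>x. x \<in> B \<Longrightarrow> norm x = 1"
      "independent B" "span B = T"
    using orthonormal_basis_subspace[OF assms] by metis
  have "finite B"
    using B(4) by (rule independent_imp_finite)
  define p where "p v = (\<Sum>b\<in>B. (v \<bullet> b) *\<^sub>R b)" for v
  have lin: "bounded_linear p"
    unfolding p_def by (intro bounded_linear_intros)
  have inB: "p v \<bullet> b = v \<bullet> b" if "b \<in> B" for v b
  proof -
    have "p v \<bullet> b = (\<Sum>c\<in>B. (v \<bullet> c) * (c \<bullet> b))"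
      by (simp add: p_def inner_sum_left)
    also have "\<dots> = (\<Sum>c\<in>B. if c = b then v \<bullet> b else 0)"
    proof (rule sum.cong[OF refl])
      fix c assume "c \<in> B"
      then show "(v \<bullet> c) * (c \<bullet> b) = (if c = b then v \<bullet> b else 0)"
        using B(2) B(3)[OF that] that
        by (auto simp: pairwise_def orthogonal_def dot_square_norm)
    qed
    finally show ?thesis
      using \<open>finite B\<close> that by simp
  qed
  have orth: "(v - p v) \<bullet> u = 0" if "u \<in> T" for v u
  proof -
    have "orthogonal (v - p v) u"
    proof (rule orthogonal_to_span)
      show "u \<in> span B"
        using that B(5) by simp
      show "orthogonal (v - p v) b" if "b \<in> B" for b
        using inB[OF that] by (simp add: orthogonal_def inner_diff_left)
    qed
    then show ?thesis
      by (simp add: orthogonal_def)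
  qed
  have inT: "p v \<in> T" for v
    unfolding p_def using B(1) by (intro subspace_sum[OF assms] subspace_scale[OF assms]) auto
  moreover have "p v = v" if "v \<in> T" for v
    using orth[OF subspace_diff[OF assms that inT[of v]], of v] by simp
  ultimately show thesis
    using that lin orth by metis
qed

section \<open>Orbits, their tangent spaces and their charts\<close>

context compact_isometry_group
begin

lemma orbE:
  assumes "x \<in> orb w"
  obtains k where "k \<in> K" "x = eapp k w"
  using assms by (auto simp: orb_def)

lemma orb_refl: "w \<in> orb w"
  using one by (force simp: orb_def)

lemma eapp_orb: "k \<in> K \<Longrightarrow> x \<in> orb w \<Longrightarrow> eapp k x \<in> orb w"
  by (auto simp: orb_def intro!: image_eqI[where x = "k * _"] mult)

lemma compact_orb: "compact (orb w)"
  unfolding orb_def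
  by (rule compact_continuous_image[OF _ compact]) (intro continuous_intros)

text \<open>The representatives of \<open>x\<close> form a closed subset of the compact
  \<open>K\<close>, on which the distance to 1 attains its minimum.\<close>

lemma minimal_representative:
  assumes "x \<in> orb w"
  obtains k where "k \<in> K" "eapp k w = x"
    "\<And>k'. k' \<in> K \<Longrightarrow> eapp k' w = x \<Longrightarrow> norm (k - 1) \<le> norm (k' - 1)"
proof -
  have "closed {k. eapp k w = x}"
    by (intro closed_Collect_eq continuous_intros)
  then have "compact (K \<inter> {k. eapp k w = x})"
    using compact by (rule compact_Int_closed[rotated])
  moreover have "K \<inter> {k. eapp k w = x} \<noteq> {}"
    using assms by (auto elim!: orbE)
  ultimately have "\<exists>k\<in>K \<inter> {k. eapp k w = x}. \<forall>k'\<in>K \<inter> {k. eapp k w = x}. norm (k - 1) \<le> norm (k' - 1)"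
    by (rule continuous_attains_inf) (intro continuous_intros)
  then show thesis
    using that by auto
qed


text \<open>
  If the shortest representatives \<open>k n\<close> of \<open>x n\<close> were not controlled by the distance of \<open>x n\<close> to \<open>w\<close>,
  then \<open>(k n - 1) / s n\<close> with \<open>s n = norm (k n - 1)\<close> would accumulate at a unit vector \<open>u\<close> of the Lie
  algebra with \<open>u w = 0\<close>, and \<open>k n * exp (- s n u)\<close> would be a shorter representative.
\<close>

lemma orbit_lipschitz_section:
  obtains c where "0 \<le> c"
    "\<And>x. x \<in> orb w \<Longrightarrow> \<exists>k\<in>K. eapp k w = x \<and> norm (k - 1) \<le> c * norm (x - w)"
proof (rule ccontr)
  assume "\<not> thesis"
  \<comment> \<open>Refuting the constants \<open>real (Suc n)\<close> gives points all of whose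
    representatives are too far from 1.\<close>
  then have "\<exists>x\<in>orb w. \<forall>k\<in>K. eapp k w = x \<longrightarrow> real (Suc n) * norm (x - w) < norm (k - 1)" for n
    using that[of "real (Suc n)"] by (meson not_le of_nat_0_le_iff)
  then obtain x where x: "\<And>n. x n \<in> orb w"
      "\<And>n k. k \<in> K \<Longrightarrow> eapp k w = x n \<Longrightarrow> real (Suc n) * norm (x n - w) < norm (k - 1)"
    by metis
  have "\<exists>k\<in>K. eapp k w = x n \<and> (\<forall>k'\<in>K. eapp k' w = x n \<longrightarrow> norm (k - 1) \<le> norm (k' - 1))" for n
    using minimal_representative[OF x(1)[of n]] by metis
  then obtain k where k: "\<And>n. k n \<in> K" "\<And>n. eapp (k n) w = x n"
      "\<And>n k'. k' \<in> K \<Longrightarrow> eapp k' w = x n \<Longrightarrow> norm (k n - 1) \<le> norm (k' - 1)"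
    by metis
  define s where "s n = norm (k n - 1)" for n
  have s_gt: "real (Suc n) * norm (x n - w) < s n" for n
    using x(2)[OF k(1,2)] by (simp add: s_def)
  have s_pos: "0 < s n" for n
    using s_gt[of n] by (smt (verit) mult_nonneg_nonneg norm_ge_zero of_nat_0_le_iff)
  have s_le: "s n \<le> 2" for n
    using norm_triangle_ineq4[of "k n" 1] norm_le_one[OF k(1)[of n]] by (simp add: s_def)
  have quot: "(\<lambda>n. (x n - w) /\<^sub>R s n) \<longlonglongrightarrow> 0"
  proof (rule Lim_null_comparison[OF always_eventually LIMSEQ_inverse_real_of_nat], rule allI)
    show "norm ((x n - w) /\<^sub>R s n) \<le> inverse (real (Suc n))" for n
      using s_gt[of n] s_pos[of n] unfolding norm_scaleR by (simp add: field_simps del: of_nat_Suc)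
  qed
  \<comment> \<open>The crude bound \<open>s n \<le> 2\<close> turns smallness of the quotients into
    convergence of \<open>x n\<close> to \<open>w\<close>.\<close>
  have "(\<lambda>n. s n *\<^sub>R ((x n - w) /\<^sub>R s n)) \<longlonglongrightarrow> 0"
  proof (rule Lim_null_comparison[OF always_eventually], rule allI)
    show "norm (s n *\<^sub>R ((x n - w) /\<^sub>R s n)) \<le> 2 * norm ((x n - w) /\<^sub>R s n)" for n
      unfolding norm_scaleR using s_pos[of n] s_le[of n] by (intro mult_right_mono) auto
    show "(\<lambda>n. 2 * norm ((x n - w) /\<^sub>R s n)) \<longlonglongrightarrow> 0"
      using tendsto_mult_right_zero[OF tendsto_norm_zero[OF quot]] .
  qed
  moreover have "s n *\<^sub>R ((x n - w) /\<^sub>R s n) = x n - w" for n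
    using s_pos[of n] by simp
  ultimately have x_lim: "x \<longlonglongrightarrow> w"
    by (intro LIM_zero_cancel[of x w]) simp
  obtain l r where l: "l \<in> K" "strict_mono r" "(\<lambda>n. k (r n)) \<longlonglongrightarrow> l"
    using compact_sequence[of K k] compact k(1) by metis
  have "(\<lambda>n. eapp (k (r n)) w) \<longlonglongrightarrow> eapp l w"
    by (intro tendsto_intros l)
  moreover have "(\<lambda>n. eapp (k (r n)) w) \<longlonglongrightarrow> w"
    using LIMSEQ_subseq_LIMSEQ[OF x_lim l(2)] by (simp add: k(2) o_def)
  ultimately have lw: "eapp l w = w"
    by (rule LIMSEQ_unique)
  obtain b where b: "b \<in> K" "l * b = 1" "b * l = 1"
    using inverse[OF l(1)] by blast
  have bw: "eapp b w = w"
    using arg_cong[OF b(3), of "\<lambda>a. eapp a w"] lw by simp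
  have sr_le: "s (r n) \<le> norm (k (r n) - l)" for n
  proof -
    \<comment> \<open>The limit \<open>l\<close> is not known to be 1, but it fixes
      \<open>w\<close>, and so does its inverse \<open>b\<close>. Hence \<open>k (r n) * b\<close>
      also represents \<open>x (r n)\<close>, and minimality applies.\<close>
    have "s (r n) \<le> norm (k (r n) * b - 1)"
      unfolding s_def using bw k(1,2) b(1) by (intro k(3)) (auto intro: mult)
    also have "k (r n) * b - 1 = (k (r n) - l) * b"
      using b(2) by (simp add: algebra_simps)
    finally show ?thesis
      by (simp add: norm_mult_right b(1))
  qed
  have sr: "(\<lambda>n. s (r n)) \<longlonglongrightarrow> 0"
  proof (rule Lim_null_comparison[OF always_eventually], rule allI)
    show "norm (s (r n)) \<le> norm (k (r n) - l)" for n
      using sr_le[of n] s_pos[of "r n"] by simp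
    show "(\<lambda>n. norm (k (r n) - l)) \<longlonglongrightarrow> 0"
      by (rule tendsto_norm_zero[OF LIM_zero[OF l(3)]])
  qed
  obtain u q where u: "norm u = 1" "strict_mono q"
      "(\<lambda>n. (k (r (q n)) - 1) /\<^sub>R norm (k (r (q n)) - 1)) \<longlonglongrightarrow> u"
    using unit_sequence_limit[of "\<lambda>n. k (r n) - 1"] s_pos by (auto simp: s_def)
  define t where "t n = s (r (q n))" for n
  have t: "\<And>n. 0 < t n" "t \<longlonglongrightarrow> 0"
    using s_pos LIMSEQ_subseq_LIMSEQ[OF sr u(2)] by (simp_all add: t_def[abs_def] o_def)
  have u_lim: "(\<lambda>n. (k (r (q n)) - 1) /\<^sub>R t n) \<longlonglongrightarrow> u"
    using u(3) by (simp add: t_def s_def)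
  have "u \<in> lie"
    using k(1) t u_lim by (rule lie_limit)
  have "(\<lambda>n. eapp ((k (r (q n)) - 1) /\<^sub>R t n) w) \<longlonglongrightarrow> eapp u w"
    by (intro tendsto_intros u_lim)
  moreover have "(\<lambda>n. eapp ((k (r (q n)) - 1) /\<^sub>R t n) w) \<longlonglongrightarrow> 0"
    using LIMSEQ_subseq_LIMSEQ[OF quot strict_mono_o[OF l(2) u(2)]]
    by (simp add: eapp.scaleR_left eapp.diff_left k(2) o_def t_def)
  ultimately have uw: "eapp u w = 0"
    by (rule LIMSEQ_unique)
  define e where "e n = exp (t n *\<^sub>R u)" for n
  \<comment> \<open>Minimality against the competitor \<open>k (r (q n)) * exp (- t n u)\<close>
    keeps the two difference quotients at distance at least 1, although both tend to
    \<open>u\<close>.\<close>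
  have "1 \<le> norm ((k (r (q n)) - 1) /\<^sub>R t n - (e n - 1) /\<^sub>R t n)" for n
  proof -
    have e': "exp ((- t n) *\<^sub>R u) \<in> K" "e n * exp ((- t n) *\<^sub>R u) = 1"
      using lie_exp[OF \<open>u \<in> lie\<close>, of "- t n"] exp_minus_inverse[of "t n *\<^sub>R u"] by (simp_all add: e_def)
    have "t n = norm (k (r (q n)) - 1)"
      by (simp add: t_def s_def)
    also have "\<dots> \<le> norm (k (r (q n)) * exp ((- t n) *\<^sub>R u) - 1)"
    proof (rule k(3))
      show "k (r (q n)) * exp ((- t n) *\<^sub>R u) \<in> K"
        by (rule mult[OF k(1) e'(1)])
      show "eapp (k (r (q n)) * exp ((- t n) *\<^sub>R u)) w = x (r (q n))"
        using eapp_exp_fixes[OF uw, of "- t n"] by (simp add: k(2))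
    qed
    also have "k (r (q n)) * exp ((- t n) *\<^sub>R u) - 1 = (k (r (q n)) - e n) * exp ((- t n) *\<^sub>R u)"
      using e'(2) by (simp add: algebra_simps)
    also have "norm \<dots> = norm (k (r (q n)) - e n)"
      by (rule norm_mult_right[OF e'(1)])
    finally have "t n \<le> norm (k (r (q n)) - e n)" .
    moreover have "(k (r (q n)) - 1) /\<^sub>R t n - (e n - 1) /\<^sub>R t n = (k (r (q n)) - e n) /\<^sub>R t n"
      by (simp flip: scaleR_diff_right)
    ultimately show ?thesis
      using t(1)[of n] by (simp add: le_divide_eq divide_inverse_commute[symmetric])
  qed
  moreover have "(\<lambda>n. norm ((k (r (q n)) - 1) /\<^sub>R t n - (e n - 1) /\<^sub>R t n)) \<longlonglongrightarrow> norm (u - u)"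
    unfolding e_def using t
    by (intro tendsto_intros u_lim exp_quotient_sequentially) (simp_all add: order_less_imp_not_eq2)
  ultimately have "1 \<le> norm (u - u)"
    by (intro LIMSEQ_le_const) auto
  then show False
    by simp
qed

text \<open>The Lipschitz choice of representatives keeps the quotients of \<open>k n - 1\<close> by
  \<open>norm (x n - w)\<close> bounded. A limit \<open>A\<close> of them lies in the Lie algebra by
  \<open>lie_limit\<close>, and evaluation at \<open>w\<close> gives \<open>u = A w\<close>.\<close>

lemma tangent_limit:
  assumes x: "\<And>n. x n \<in> orb w" "\<And>n. x n \<noteq> w" "x \<longlonglongrightarrow> w"
    and u: "(\<lambda>n. (x n - w) /\<^sub>R norm (x n - w)) \<longlonglongrightarrow> u"
  shows "u \<in> tangent w"
proof -
  obtain c where "0 \<le> c"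
    and c: "\<And>x. x \<in> orb w \<Longrightarrow> \<exists>k\<in>K. eapp k w = x \<and> norm (k - 1) \<le> c * norm (x - w)"
    using orbit_lipschitz_section[of w] by blast
  obtain k where k: "\<And>n. k n \<in> K" "\<And>n. eapp (k n) w = x n"
      "\<And>n. norm (k n - 1) \<le> c * norm (x n - w)"
    using c[OF x(1)] by metis
  have "(k n - 1) /\<^sub>R norm (x n - w) \<in> cball 0 c" for n
    using k(3)[of n] x(2)[of n] by (simp add: divide_inverse_commute[symmetric] divide_le_eq)
  with compact_cball obtain A r where A: "strict_mono r"
      "(\<lambda>n. (k (r n) - 1) /\<^sub>R norm (x (r n) - w)) \<longlonglongrightarrow> A"
    by (rule compact_sequence)
  have "(\<lambda>n. norm (x (r n) - w)) \<longlonglongrightarrow> 0"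
    using LIMSEQ_subseq_LIMSEQ[OF tendsto_norm_zero[OF LIM_zero[OF x(3)]] A(1)] by (simp add: o_def)
  then have "A \<in> lie"
    using A(2) x(2) by (intro lie_limit[of "\<lambda>n. k (r n)" "\<lambda>n. norm (x (r n) - w)"] k(1)) auto
  have "(\<lambda>n. eapp ((k (r n) - 1) /\<^sub>R norm (x (r n) - w)) w) \<longlonglongrightarrow> eapp A w"
    by (intro tendsto_intros A)
  moreover have "(\<lambda>n. eapp ((k (r n) - 1) /\<^sub>R norm (x (r n) - w)) w) \<longlonglongrightarrow> u"
    using LIMSEQ_subseq_LIMSEQ[OF u A(1)] by (simp add: o_def eapp.scaleR_left eapp.diff_left k(2))
  ultimately have "eapp A w = u"
    by (rule LIMSEQ_unique)
  then show ?thesis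
    using \<open>A \<in> lie\<close> by (auto simp: tangent_def)
qed

lemma subspace_tangent: "subspace (tangent w)"
  unfolding tangent_def
  by (rule linear_subspace_image[OF bounded_linear.linear[OF eapp.bounded_linear_left] subspace_lie])

text \<open>Turns tangent vectors linearly into infinitesimal generators, by a right inverse of
  evaluation at \<open>w\<close> on the Lie algebra.\<close>

lemma tangent_section:
  obtains g where "bounded_linear g" "\<And>v. g v \<in> lie" "\<And>u. u \<in> tangent w \<Longrightarrow> eapp (g u) w = u"
proof -
  have "linear (\<lambda>A. eapp A w)"
    by (rule bounded_linear.linear[OF eapp.bounded_linear_left])
  from linear_exists_right_inverse_on[OF this subspace_lie]
  obtain g where "range g \<subseteq> lie" "linear g" "\<forall>v\<in>tangent w. eapp (g v) w = v"
    by (auto simp: tangent_def)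
  then show thesis
    using that[of g] by (auto simp: linear_conv_bounded_linear)
qed

text \<open>An open mapping argument: the points \<open>exp (g u) w\<close> follow every tangent
  vector \<open>u\<close> to first order, so their projections fill a neighbourhood of
  \<open>p w\<close> in the tangent space.\<close>

lemma projection_covers:
  assumes p: "bounded_linear p" "\<And>v. p v \<in> tangent w" "\<And>v. v \<in> tangent w \<Longrightarrow> p v = v"
    and "0 < \<epsilon>"
  obtains r where "0 < r"
    "\<And>y. y \<in> tangent w \<Longrightarrow> dist y (p w) < r \<Longrightarrow> \<exists>x\<in>orb w. dist x w < \<epsilon> \<and> p x = y"
proof -
  interpret p: bounded_linear p
    by fact
  obtain g where g: "bounded_linear g" "\<And>v. g v \<in> lie" "\<And>u. u \<in> tangent w \<Longrightarrow> eapp (g u) w = u"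
    using tangent_section[of w] by metis
  interpret g: bounded_linear g
    by fact
  define F where "F v = eapp (exp (g (p v))) w" for v
  \<comment> \<open>The normal part \<open>v - p v\<close> is added so that the map acts on the
    whole space with the identity as its derivative at 0, where the open mapping theorem
    applies.\<close>
  define \<Phi> where "\<Phi> v = p (F v) + (v - p v)" for v
  have F_orb: "F v \<in> orb w" for v
    using lie_exp[OF g(2), of 1] by (simp add: F_def orb_def)
  have F0: "F 0 = w"
    by (simp add: F_def p.zero g.zero)
  have "continuous_on UNIV (\<lambda>v. exp (g (p v)))"
    by (rule continuous_on_compose2[OF continuous_on_exp_algebra])
      (auto intro!: g.continuous_on p.continuous_on continuous_on_id)
  then have F_cont: "continuous_on UNIV F"
    unfolding F_def by (intro continuous_intros)
  then have \<Phi>_cont: "continuous_on UNIV \<Phi>"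
    unfolding \<Phi>_def by (intro continuous_intros p.continuous_on)
  have "((\<lambda>v. g (p v)) has_derivative (\<lambda>h. g (p h))) (at 0)"
    by (rule bounded_linear_imp_has_derivative[OF bounded_linear_compose[OF g(1) p(1)]])
  then have "((\<lambda>v. exp (g (p v))) has_derivative (\<lambda>h. g (p h))) (at 0)"
    by (rule has_derivative_compose) (simp add: p.zero g.zero has_derivative_exp_0)
  then have "(\<Phi> has_derivative (\<lambda>h. p (eapp (g (p h)) w) + (h - p h))) (at 0)"
    unfolding \<Phi>_def F_def
    by (intro has_derivative_add has_derivative_diff has_derivative_ident
        p.has_derivative bounded_linear.has_derivative[OF eapp.bounded_linear_left])
  then have \<Phi>_deriv: "(\<Phi> has_derivative (\<lambda>h. h)) (at 0)"
    by (simp add: g(3) p(2,3))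
  define S where "S = F -` ball w \<epsilon>"
  have "open S"
    unfolding S_def using F_cont by (rule open_vimage[OF open_ball])
  have "0 \<in> S"
    using \<open>0 < \<epsilon>\<close> by (simp add: S_def F0)
  have "\<Phi> 0 \<in> interior (\<Phi> ` S)"
  proof (rule sussmann_open_mapping[OF \<open>open S\<close> continuous_on_subset[OF \<Phi>_cont] \<open>0 \<in> S\<close> \<Phi>_deriv bounded_linear_ident])
    show "(\<lambda>h. h) \<circ> (\<lambda>h. h) = (id :: 'v \<Rightarrow> 'v)"
      by auto
    show "0 \<in> interior S"
      using \<open>open S\<close> \<open>0 \<in> S\<close> by (simp add: interior_open)
  qed auto
  moreover have "\<Phi> 0 = p w"
    by (simp add: \<Phi>_def F0 p.zero)
  ultimately obtain r where r: "0 < r" "ball (p w) r \<subseteq> \<Phi> ` S"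
    by (auto simp: mem_interior)
  have "\<exists>x\<in>orb w. dist x w < \<epsilon> \<and> p x = y" if y: "y \<in> tangent w" "dist y (p w) < r" for y
  proof -
    have "y \<in> \<Phi> ` S"
      using r(2) y(2) by (auto simp: dist_commute)
    then obtain v where v: "v \<in> S" "y = \<Phi> v"
      by blast
    \<comment> \<open>Applying \<open>p\<close> removes the normal correction: the tangent vector
      \<open>y\<close> is the projection of the orbit point \<open>F v\<close>.\<close>
    have "p y = p (p (F v)) + (p v - p (p v))"
      by (simp add: v(2) \<Phi>_def p.add p.diff)
    then have "y = p (F v)"
      using y(1) by (simp add: p(2,3))
    then show ?thesis
      using F_orb[of v] v(1) by (auto simp: S_def dist_commute)
  qed
  then show thesis
    using r(1) that by blast
qed

text \<open>
  A secant between points \<open>x n\<close> and \<open>y n = h n w\<close> with equal projections is carried by the inverse of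
  \<open>h n\<close> to a secant at \<open>w\<close>. As \<open>h n\<close> tends to 1, its limiting direction is both tangent and normal.
\<close>

lemma projection_locally_injective:
  assumes p: "bounded_linear p" "\<And>v u. u \<in> tangent w \<Longrightarrow> (v - p v) \<bullet> u = 0"
  obtains \<epsilon> where "0 < \<epsilon>" "inj_on p (orb w \<inter> cball w \<epsilon>)"
proof (rule ccontr)
  interpret p: bounded_linear p
    by fact
  assume "\<not> thesis"
  have not_inj: "\<not> inj_on p (orb w \<inter> cball w (inverse (real (Suc n))))" for n
  proof
    assume "inj_on p (orb w \<inter> cball w (inverse (real (Suc n))))"
    then have thesis
      by (rule that[rotated]) simp
    with \<open>\<not> thesis\<close> show False ..
  qed
  have "\<exists>x y. x \<in> orb w \<and> y \<in> orb w \<and> dist w x \<le> inverse (real (Suc n)) \<and>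
      dist w y \<le> inverse (real (Suc n)) \<and> p x = p y \<and> x \<noteq> y" for n
    using not_inj[of n] unfolding inj_on_def Ball_def mem_cball Int_iff by meson
  then obtain x y where xy: "\<And>n. x n \<in> orb w" "\<And>n. y n \<in> orb w"
      "\<And>n. dist w (x n) \<le> inverse (real (Suc n))" "\<And>n. dist w (y n) \<le> inverse (real (Suc n))"
      "\<And>n. p (x n) = p (y n)" "\<And>n. x n \<noteq> y n"
    by metis
  have x_lim: "(\<lambda>n. norm (x n - w)) \<longlonglongrightarrow> 0"
    using xy(3) by (intro Lim_null_comparison[OF always_eventually LIMSEQ_inverse_real_of_nat])
      (simp add: dist_norm norm_minus_commute)
  have y_lim: "(\<lambda>n. norm (y n - w)) \<longlonglongrightarrow> 0"
    using xy(4) by (intro Lim_null_comparison[OF always_eventually LIMSEQ_inverse_real_of_nat])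
      (simp add: dist_norm norm_minus_commute)
  obtain c where c: "\<And>x. x \<in> orb w \<Longrightarrow> \<exists>k\<in>K. eapp k w = x \<and> norm (k - 1) \<le> c * norm (x - w)"
    using orbit_lipschitz_section[of w] by blast
  then obtain h where h: "\<And>n. h n \<in> K" "\<And>n. eapp (h n) w = y n"
      "\<And>n. norm (h n - 1) \<le> c * norm (y n - w)"
    using c[OF xy(2)] by metis
  have "(\<lambda>n. h n - 1) \<longlonglongrightarrow> 0"
    using h(3) by (intro Lim_null_comparison[OF always_eventually tendsto_mult_right_zero[OF y_lim]]) auto
  then have h_lim: "h \<longlonglongrightarrow> 1"
    by (rule LIM_zero_cancel)
  have "\<exists>b\<in>K. h n * b = 1 \<and> b * h n = 1" for n
    using inverse[OF h(1)] .
  then obtain b where b: "\<And>n. b n \<in> K" "\<And>n. h n * b n = 1" "\<And>n. b n * h n = 1"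
    by metis
  define z where "z n = eapp (b n) (x n)" for n
  have bh: "eapp (b n) (eapp (h n) v) = v" "eapp (h n) (eapp (b n) v) = v" for n v
    using arg_cong[OF b(3)[of n], of "\<lambda>a. eapp a v"] arg_cong[OF b(2)[of n], of "\<lambda>a. eapp a v"]
    by simp_all
  have zw: "z n - w = eapp (b n) (x n - y n)" for n
    by (simp add: z_def eapp.diff_right bh(1) flip: h(2))
  have norm_zw: "norm (z n - w) = norm (x n - y n)" for n
    by (simp add: zw isometry b(1))
  have hz: "eapp (h n) (z n - w) = x n - y n" for n
    by (simp add: zw bh)
  have z_orb: "z n \<in> orb w" for n
    unfolding z_def by (rule eapp_orb[OF b(1) xy(1)])
  have z_ne: "z n \<noteq> w" for n
    using norm_zw[of n] xy(6)[of n] by auto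
  have "(\<lambda>n. z n - w) \<longlonglongrightarrow> 0"
  proof (rule Lim_null_comparison[OF always_eventually], rule allI)
    show "norm (z n - w) \<le> norm (x n - w) + norm (y n - w)" for n
      unfolding norm_zw using norm_triangle_ineq4[of "x n - w" "y n - w"] by simp
    show "(\<lambda>n. norm (x n - w) + norm (y n - w)) \<longlonglongrightarrow> 0"
      using tendsto_add[OF x_lim y_lim] by simp
  qed
  then have z_lim: "z \<longlonglongrightarrow> w"
    by (rule LIM_zero_cancel)
  obtain u r where u: "norm u = 1" "strict_mono r" "(\<lambda>n. (z (r n) - w) /\<^sub>R norm (z (r n) - w)) \<longlonglongrightarrow> u"
    by (rule unit_sequence_limit[of "\<lambda>n. z n - w"]) (simp add: z_ne)
  have "(\<lambda>n. z (r n)) \<longlonglongrightarrow> w"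
    using LIMSEQ_subseq_LIMSEQ[OF z_lim u(2)] by (simp add: o_def)
  with z_orb z_ne have "u \<in> tangent w"
    using u(3) by (rule tangent_limit)
  have "eapp (h (r n)) ((z (r n) - w) /\<^sub>R norm (z (r n) - w)) \<bullet> u = 0" for n
    using p(2)[OF \<open>u \<in> tangent w\<close>, of "x (r n) - y (r n)"] xy(5)[of "r n"]
    by (simp add: eapp.scaleR_right hz p.diff)
  moreover have "(\<lambda>n. eapp (h (r n)) ((z (r n) - w) /\<^sub>R norm (z (r n) - w)) \<bullet> u) \<longlonglongrightarrow> eapp 1 u \<bullet> u"
    using LIMSEQ_subseq_LIMSEQ[OF h_lim u(2)] by (intro tendsto_intros u(3)) (simp add: o_def)
  ultimately have "u \<bullet> u = 0"
    by (simp add: LIMSEQ_const_iff)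
  then show False
    using u(1) by simp
qed

text \<open>On the compact set \<open>?N\<close> the injective map \<open>p\<close> is a
  homeomorphism onto its image. By \<open>projection_covers\<close> this image contains a
  neighbourhood of \<open>p w\<close> in the tangent space, so the chart can be cut down to open
  sets on both sides.\<close>

lemma orbit_chart:
  obtains U W where "openin (top_of_set (orb w)) U" "w \<in> U"
    "openin (top_of_set (tangent w)) W" "U homeomorphic W"
proof -
  obtain p where p: "bounded_linear p" "\<And>v. p v \<in> tangent w" "\<And>v. v \<in> tangent w \<Longrightarrow> p v = v"
      "\<And>v u. u \<in> tangent w \<Longrightarrow> (v - p v) \<bullet> u = 0"
    using orthogonal_projection_exists[OF subspace_tangent] by metis
  obtain \<epsilon> where \<epsilon>: "0 < \<epsilon>" "inj_on p (orb w \<inter> cball w \<epsilon>)"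
    using projection_locally_injective[OF p(1,4)] by blast
  obtain r where r: "0 < r"
      "\<And>y. y \<in> tangent w \<Longrightarrow> dist y (p w) < r \<Longrightarrow> \<exists>x\<in>orb w. dist x w < \<epsilon> \<and> p x = y"
    using projection_covers[OF p(1,2,3) \<epsilon>(1)] by blast
  have p_cont: "continuous_on S p" for S
    by (rule linear_continuous_on[OF p(1)])
  let ?N = "orb w \<inter> cball w \<epsilon>"
  have "compact ?N"
    by (intro compact_Int compact_orb compact_cball)
  then obtain q where q: "homeomorphism ?N (p ` ?N) p q"
    using homeomorphism_compact[OF _ p_cont refl \<epsilon>(2)] by blast
  define U where "U = orb w \<inter> (ball w \<epsilon> \<inter> p -` ball (p w) r)"
  define D where "D = tangent w \<inter> ball (p w) r"
  have D_sub: "D \<subseteq> p ` ?N"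
    using r(2) by (fastforce simp: D_def dist_commute)
  \<comment> \<open>Describing the image through the inverse \<open>q\<close> makes it open in
    \<open>D\<close>, by continuity of \<open>q\<close>.\<close>
  have pU: "p ` U = D \<inter> q -` ball w \<epsilon>"
  proof (intro equalityI subsetI)
    fix y assume "y \<in> p ` U"
    then obtain x where x: "x \<in> U" "y = p x"
      by blast
    then have "q y = x"
      using homeomorphism_apply1[OF q, of x] by (auto simp: U_def)
    then show "y \<in> D \<inter> q -` ball w \<epsilon>"
      using x p(2) by (auto simp: U_def D_def)
  next
    fix y assume y: "y \<in> D \<inter> q -` ball w \<epsilon>"
    then have "y \<in> p ` ?N"
      using D_sub by blast
    then have "p (q y) = y" "q y \<in> ?N"
      using homeomorphism_apply2[OF q, of y] homeomorphism_image2[OF q] by blast+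
    then show "y \<in> p ` U"
      using y by (auto simp: U_def D_def intro!: image_eqI[of y p "q y"])
  qed
  have "openin (top_of_set D) (D \<inter> q -` ball w \<epsilon>)"
    using continuous_on_subset[OF homeomorphism_cont2[OF q] D_sub]
    by (rule continuous_openin_preimage_gen) simp
  moreover have "openin (top_of_set (tangent w)) D"
    unfolding D_def by (rule openin_open_Int) simp
  ultimately have "openin (top_of_set (tangent w)) (p ` U)"
    unfolding pU by (rule openin_trans)
  moreover have "openin (top_of_set (orb w)) U"
    unfolding U_def
    by (intro openin_open_Int open_Int open_ball open_vimage p_cont)
  moreover have "w \<in> U"
    using \<epsilon>(1) r(1) orb_refl by (simp add: U_def)
  moreover have "U homeomorphic p ` U"
  proof -
    have "homeomorphism U (p ` U) p q"
      by (rule homeomorphism_of_subsets[OF q, of U "p ` U"]) (auto simp: U_def)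
    then show ?thesis
      unfolding homeomorphic_def by blast
  qed
  ultimately show thesis
    using that by blast
qed

text \<open>Homogeneity: an element \<open>k\<close> carrying \<open>w\<close> to \<open>x\<close>
  also carries the chart at \<open>w\<close> to one at \<open>x\<close>.\<close>

lemma locally_euclidean_orb: "locally_euclidean (dim (tangent w)) (orb w)"
  unfolding locally_euclidean_def
proof
  fix x assume "x \<in> orb w"
  then obtain k where k: "k \<in> K" "x = eapp k w"
    by (rule orbE)
  obtain b where b: "b \<in> K" "k * b = 1" "b * k = 1"
    using inverse[OF k(1)] by blast
  have bk: "eapp b (eapp k v) = v" "eapp k (eapp b v) = v" for v
    using arg_cong[OF b(3), of "\<lambda>a. eapp a v"] arg_cong[OF b(2), of "\<lambda>a. eapp a v"] by simp_all
  obtain U W where U: "openin (top_of_set (orb w)) U" "w \<in> U"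
    and W: "openin (top_of_set (tangent w)) W" "U homeomorphic W"
    by (rule orbit_chart)
  have cont: "continuous_on S (eapp a)" for S a
    by (intro continuous_intros)
  from U(1) obtain V where V: "open V" "U = orb w \<inter> V"
    by (auto simp: openin_open)
  have "eapp k ` U = orb w \<inter> eapp b -` V"
  proof (intro equalityI subsetI)
    fix y assume "y \<in> orb w \<inter> eapp b -` V"
    then show "y \<in> eapp k ` U"
      using eapp_orb[OF b(1), of y w] bk(2)[of y] by (auto simp: V(2) intro!: image_eqI[of y _ "eapp b y"])
  qed (use eapp_orb[OF k(1)] bk in \<open>auto simp: V(2)\<close>)
  then have "openin (top_of_set (orb w)) (eapp k ` U)"
    using openin_open_Int[OF open_vimage[OF V(1) cont]] by simp
  moreover have "homeomorphism (eapp k ` U) U (eapp b) (eapp k)"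
    unfolding homeomorphism_def by (auto simp: bk image_image cont)
  then have "eapp k ` U homeomorphic U"
    unfolding homeomorphic_def by blast
  then have UW: "eapp k ` U homeomorphic W"
    using W(2) by (rule homeomorphic_trans)
  moreover have "\<exists>(L :: 'v set) W. subspace L \<and> dim L = dim (tangent w) \<and> openin (top_of_set L) W \<and>
      eapp k ` U homeomorphic W"
    by (rule exI[of _ "tangent w"], rule exI[of _ W]) (intro conjI subspace_tangent refl W(1) UW)
  ultimately show "\<exists>U. openin (top_of_set (orb w)) U \<and> x \<in> U \<and>
      (\<exists>(L :: 'v set) W. subspace L \<and> dim L = dim (tangent w) \<and> openin (top_of_set L) W \<and> U homeomorphic W)"
    unfolding k(2)
    by - (rule exI[of _ "eapp k ` U"], simp add: U(2))
qed

end

section \<open>Uniqueness of the dimension of a locally Euclidean set\<close>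

lemma locally_euclidean_dim_le:
  fixes M :: "'v::euclidean_space set"
  assumes "locally_euclidean k M" "locally_euclidean l M" "M \<noteq> {}"
  shows "k \<le> l"
proof -
  obtain x where "x \<in> M"
    using assms(3) by blast
  obtain U and L W :: "'v set" where U: "openin (top_of_set M) U" "x \<in> U" "subspace L" "dim L = k"
      "openin (top_of_set L) W" "U homeomorphic W"
    using bspec[OF assms(1)[unfolded locally_euclidean_def] \<open>x \<in> M\<close>] by (elim exE conjE) (rule that)
  obtain U' and L' W' :: "'v set" where U': "openin (top_of_set M) U'" "x \<in> U'" "subspace L'" "dim L' = l"
      "openin (top_of_set L') W'" "U' homeomorphic W'"
    using bspec[OF assms(2)[unfolded locally_euclidean_def] \<open>x \<in> M\<close>] by (elim exE conjE) (rule that)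
  obtain f g where f: "homeomorphism U W f g"
    using U(6) homeomorphic_def by blast
  obtain f' g' where f': "homeomorphism U' W' f' g'"
    using U'(6) homeomorphic_def by blast
  \<comment> \<open>On the overlap the transition \<open>f' \<circ> g\<close> is a continuous
    injection of a nonempty open subset of \<open>L\<close> into \<open>L'\<close>, so invariance of
    dimension applies.\<close>
  let ?V = "U \<inter> U'"
  have "openin (top_of_set U) ?V"
    using openin_Int[OF U(1) U'(1)] openin_imp_subset[OF U(1)] openin_subset_trans by blast
  then have "openin (top_of_set W) (f ` ?V)"
    by (rule homeomorphism_imp_open_map[OF f])
  then have "openin (top_of_set L) (f ` ?V)"
    using U(5) by (rule openin_trans)
  then have "dim L \<le> dim L'"
  proof (rule invariance_of_dimension_subspaces[OF _ U(3) U'(3)])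
    have g: "g (f v) = v" if "v \<in> ?V" for v
      using that by (intro homeomorphism_apply1[OF f]) simp
    have g_im: "g ` f ` ?V = ?V"
      unfolding image_image using g by simp
    have "continuous_on (f ` ?V) g"
      using homeomorphism_image1[OF f] by (intro continuous_on_subset[OF homeomorphism_cont2[OF f]]) auto
    moreover have "continuous_on (g ` f ` ?V) f'"
      unfolding g_im by (intro continuous_on_subset[OF homeomorphism_cont1[OF f']]) auto
    ultimately show "continuous_on (f ` ?V) (f' \<circ> g)"
      by (rule continuous_on_compose)
    show "f' \<circ> g \<in> f ` ?V \<rightarrow> L'"
      using homeomorphism_image1[OF f'] openin_imp_subset[OF U'(5)] g by auto
    have "inj_on f' U'"
      using homeomorphism_apply1[OF f'] by (rule inj_on_inverseI)
    then show "inj_on (f' \<circ> g) (f ` ?V)"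
      using g by (auto simp: inj_on_def)
    show "f ` ?V \<noteq> {}"
      using U(2) U'(2) by blast
  qed
  then show ?thesis
    using U(4) U'(4) by simp
qed

lemma manifold_dim_eq:
  assumes "locally_euclidean k M" "M \<noteq> {}"
  shows "manifold_dim M = k"
  unfolding manifold_dim_def
  using assms locally_euclidean_dim_le by (blast intro: the_equality order_antisym)

lemma (in compact_isometry_group) manifold_dim_orb: "manifold_dim (orb w) = dim (tangent w)"
  using locally_euclidean_orb orb_refl by (intro manifold_dim_eq) auto

section \<open>Slices and kernels\<close>

context compact_isometry_group
begin

text \<open>The one-parameter group of some \<open>A\<close> with \<open>u = A w\<close> supplies
  the curve.\<close>

lemma tangent_curve:
  assumes "u \<in> tangent w"
  obtains \<gamma> where "\<And>t. \<gamma> t \<in> orb w" "\<gamma> 0 = w" "(\<gamma> has_vector_derivative u) (at (0::real))"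
proof -
  obtain A where A: "A \<in> lie" "u = eapp A w"
    using assms by (auto simp: tangent_def)
  have "((\<lambda>t. eapp (exp (t *\<^sub>R A)) w) has_vector_derivative eapp (exp (0 *\<^sub>R A) * A) w) (at 0)"
    by (rule bounded_linear.has_vector_derivative[OF eapp.bounded_linear_left
        exp_scaleR_has_vector_derivative_right])
  then show thesis
    using lie_exp[OF A(1)] by (intro that[of "\<lambda>t. eapp (exp (t *\<^sub>R A)) w"]) (auto simp: orb_def A(2))
qed

text \<open>Along a curve in the orbit with velocity \<open>u\<close> the function \<open>f\<close>
  is constantly 0, and the chain rule identifies its derivative there with
  \<open>H u\<close>.\<close>

lemma tangent_in_kernel:
  assumes "\<And>x. x \<in> orb w \<Longrightarrow> f x = 0" "(f has_derivative H) (at w)" "u \<in> tangent w"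
  shows "H u = 0"
proof -
  obtain \<gamma> where \<gamma>: "\<And>t. \<gamma> t \<in> orb w" "\<gamma> 0 = w" "(\<gamma> has_vector_derivative u) (at (0::real))"
    using tangent_curve[OF assms(3)] by blast
  have "((\<lambda>t. f (\<gamma> t)) has_derivative (\<lambda>t. H (t *\<^sub>R u))) (at 0)"
    using \<gamma>(3)[unfolded has_vector_derivative_def] by (rule has_derivative_compose) (simp add: \<gamma>(2) assms(2))
  then have "((\<lambda>t::real. 0) has_derivative (\<lambda>t. H (t *\<^sub>R u))) (at 0)"
    by (simp add: assms(1) \<gamma>(1))
  from has_derivative_unique[OF this has_derivative_const]
  have "H (1 *\<^sub>R u) = 0"
    by (rule fun_cong)
  then show ?thesis
    by simp
qed

text \<open>Moving \<open>v\<close> as close to \<open>w\<close> as the group allows makes \<open>v - w\<close> normal to the orbit of \<open>w\<close>.\<close>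

lemma move_to_slice:
  obtains k where "k \<in> K" "norm (eapp k v - w) \<le> norm (v - w)"
    "\<And>u. u \<in> tangent w \<Longrightarrow> (eapp k v - w) \<bullet> u = 0"
proof -
  have "\<exists>k\<in>K. \<forall>k'\<in>K. norm (eapp k v - w) \<le> norm (eapp k' v - w)"
    using one by (intro continuous_attains_inf[OF compact] continuous_intros) auto
  then obtain k where k: "k \<in> K" "\<And>k'. k' \<in> K \<Longrightarrow> norm (eapp k v - w) \<le> norm (eapp k' v - w)"
    by blast
  \<comment> \<open>By isometry, moving \<open>v\<close> with \<open>w\<close> fixed amounts to
    fixing \<open>eapp k v\<close> and letting \<open>y\<close> run through the orbit of
    \<open>w\<close>.\<close>
  have min: "norm (eapp k v - w) \<le> norm (eapp k v - y)" if y: "y \<in> orb w" for y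
  proof -
    obtain a where a: "a \<in> K" "y = eapp a w"
      using y by (auto simp: orb_def)
    obtain b where b: "b \<in> K" "b * a = 1"
      using inverse[OF a(1)] by blast
    have "eapp b y = w"
      using arg_cong[OF b(2), of "\<lambda>c. eapp c w"] by (simp add: a(2))
    then have "eapp (b * k) v - w = eapp b (eapp k v - y)"
      by (simp add: eapp.diff_right)
    then have "norm (eapp (b * k) v - w) = norm (eapp k v - y)"
      by (simp only: isometry[OF b(1)])
    then show ?thesis
      using k(2)[OF mult[OF b(1) k(1)]] by simp
  qed
  have "(eapp k v - w) \<bullet> u = 0" if u: "u \<in> tangent w" for u
  proof -
    obtain \<gamma> where \<gamma>: "\<And>t. \<gamma> t \<in> orb w" "\<gamma> 0 = w" "(\<gamma> has_vector_derivative u) (at (0::real))"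
      using tangent_curve[OF u] by blast
    \<comment> \<open>The squared distance to the curve is differentiable and minimal at 0, so its
      derivative there vanishes.\<close>
    have "((\<lambda>t. (eapp k v - \<gamma> t) \<bullet> (eapp k v - \<gamma> t)) has_derivative
        (\<lambda>t. - 2 * ((eapp k v - w) \<bullet> u) * t)) (at 0)"
      using \<gamma>(3)[unfolded has_vector_derivative_def]
      by (auto intro!: derivative_eq_intros simp: \<gamma>(2) inner_commute fun_eq_iff)
    then have "((\<lambda>t. (eapp k v - \<gamma> t) \<bullet> (eapp k v - \<gamma> t)) has_real_derivative
        - 2 * ((eapp k v - w) \<bullet> u)) (at 0)"
      by (simp only: has_field_derivative_def)
    moreover have "(eapp k v - \<gamma> 0) \<bullet> (eapp k v - \<gamma> 0) \<le> (eapp k v - \<gamma> t) \<bullet> (eapp k v - \<gamma> t)" for t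
      using min[OF \<gamma>(1)[of t]] by (simp add: \<gamma>(2) norm_le)
    ultimately have "- 2 * ((eapp k v - w) \<bullet> u) = 0"
      by (intro DERIV_local_min[where d = 1]) auto
    then show ?thesis
      by simp
  qed
  then show thesis
    using that[OF k(1)] k(2)[OF one] by simp
qed

end

section \<open>Kernel vectors from coinciding values\<close>

lemma onorm_le_sum_Basis:
  fixes f :: "'a::euclidean_space \<Rightarrow> 'b::real_normed_vector"
  assumes "linear f"
  shows "onorm f \<le> (\<Sum>i\<in>Basis. norm (f i))"
proof (rule onorm_bound)
  show "norm (f x) \<le> (\<Sum>i\<in>Basis. norm (f i)) * norm x" for x
  proof -
    have "f x = f (\<Sum>i\<in>Basis. (x \<bullet> i) *\<^sub>R i)"
      by (simp add: euclidean_representation)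
    also have "\<dots> = (\<Sum>i\<in>Basis. (x \<bullet> i) *\<^sub>R f i)"
      by (simp add: linear_sum[OF assms] linear_scale[OF assms])
    also have "norm \<dots> \<le> (\<Sum>i\<in>Basis. norm (f i) * norm x)"
    proof (rule sum_norm_le)
      show "norm ((x \<bullet> i) *\<^sub>R f i) \<le> norm (f i) * norm x" if "i \<in> Basis" for i
        using mult_right_mono[OF Basis_le_norm[OF that, of x], of "norm (f i)"] by (simp add: mult.commute)
    qed
    finally show ?thesis
      by (simp add: sum_distrib_right)
  qed
qed (simp add: sum_nonneg)

text \<open>Near \<open>(w, \<rho>0)\<close> the map \<open>f\<close> differs from the linear map
  \<open>D w \<rho>0\<close> by an arbitrarily small Lipschitz error. Equal values at
  \<open>x n\<close> and \<open>y n\<close> thus force \<open>D w \<rho>0\<close> to be almost zero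
  on their normalized difference.\<close>

lemma kernel_of_colliding_values:
  fixes f :: "'a::euclidean_space \<Rightarrow> real \<Rightarrow> 'b::real_normed_vector"
  assumes "open \<Omega>" "w \<in> \<Omega>"
    and deriv: "\<And>v \<rho>. v \<in> \<Omega> \<Longrightarrow> ((\<lambda>u. f u \<rho>) has_derivative D v \<rho>) (at v)"
    and cont: "\<And>h. continuous_on (\<Omega> \<times> UNIV) (\<lambda>(v, \<rho>). D v \<rho> h)"
    and lim: "x \<longlonglongrightarrow> w" "y \<longlonglongrightarrow> w" "\<rho> \<longlonglongrightarrow> \<rho>0"
    and xy: "\<And>n. x n \<noteq> y n" "\<And>n. f (x n) (\<rho> n) = f (y n) (\<rho> n)"
  obtains u r where "norm u = 1" "strict_mono r"
    "(\<lambda>n. (x (r n) - y (r n)) /\<^sub>R norm (x (r n) - y (r n))) \<longlonglongrightarrow> u" "D w \<rho>0 u = 0"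
proof -
  obtain u r where u: "norm u = 1" "strict_mono r"
      "(\<lambda>n. (x (r n) - y (r n)) /\<^sub>R norm (x (r n) - y (r n))) \<longlonglongrightarrow> u"
    by (rule unit_sequence_limit[of "\<lambda>n. x n - y n"]) (simp add: xy(1))
  \<comment> \<open>A continuous majorant of the operator norm of
    \<open>D v \<rho> - D w \<rho>0\<close> that vanishes at \<open>(w, \<rho>0)\<close>. It needs
    continuity of \<open>D\<close> only in each fixed direction.\<close>
  define Q where "Q = (\<lambda>(v, \<rho>). \<Sum>i\<in>Basis. norm (D v \<rho> i - D w \<rho>0 i))"
  have D_bl: "bounded_linear (D v \<rho>)" if "v \<in> \<Omega>" for v \<rho>
    using deriv[OF that] by (rule has_derivative_bounded_linear)
  note D0 = D_bl[OF \<open>w \<in> \<Omega>\<close>, of \<rho>0]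
  have Q_cont: "continuous_on (\<Omega> \<times> UNIV) Q"
    unfolding Q_def split_def using cont[unfolded split_def] by (intro continuous_intros)
  have "norm (D w \<rho>0 u) \<le> \<epsilon>" if "0 < \<epsilon>" for \<epsilon>
  proof -
    have "open (\<Omega> \<times> (UNIV :: real set))"
      using \<open>open \<Omega>\<close> by (intro open_Times) auto
    then have "open (Q -` {..<\<epsilon>} \<inter> \<Omega> \<times> UNIV)"
      using continuous_on_open_vimage[of "\<Omega> \<times> UNIV" Q] Q_cont open_lessThan by blast
    moreover have "(w, \<rho>0) \<in> Q -` {..<\<epsilon>} \<inter> \<Omega> \<times> UNIV"
      using that \<open>w \<in> \<Omega>\<close> by (simp add: Q_def)
    ultimately obtain A B where AB: "open A" "open B" "(w, \<rho>0) \<in> A \<times> B"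
        "A \<times> B \<subseteq> Q -` {..<\<epsilon>} \<inter> \<Omega> \<times> UNIV"
      by (rule open_prod_elim)
    then obtain \<delta> where \<delta>: "0 < \<delta>" "ball w \<delta> \<subseteq> A"
      using open_contains_ball[of A] by auto
    have "\<forall>\<^sub>F n in sequentially. norm (D w \<rho>0 ((x n - y n) /\<^sub>R norm (x n - y n))) \<le> \<epsilon>"
    proof -
      have "\<forall>\<^sub>F n in sequentially. x n \<in> ball w \<delta>" "\<forall>\<^sub>F n in sequentially. y n \<in> ball w \<delta>"
          "\<forall>\<^sub>F n in sequentially. \<rho> n \<in> B"
        using topological_tendstoD[OF lim(1) open_ball] topological_tendstoD[OF lim(2) open_ball]
          topological_tendstoD[OF lim(3) AB(2)] \<delta>(1) AB(3) by simp_all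
      then show ?thesis
      proof eventually_elim
        case (elim n)
        have in_A: "v \<in> \<Omega>" "Q (v, \<rho> n) < \<epsilon>" if v: "v \<in> ball w \<delta>" for v
        proof -
          have "(v, \<rho> n) \<in> A \<times> B"
            using v \<delta>(2) elim(3) by blast
          then have "(v, \<rho> n) \<in> Q -` {..<\<epsilon>} \<inter> \<Omega> \<times> UNIV"
            using AB(4) by blast
          then show "v \<in> \<Omega>" "Q (v, \<rho> n) < \<epsilon>"
            by auto
        qed
        \<comment> \<open>Mean value inequality for \<open>f\<close> minus the linear map
          \<open>D w \<rho>0\<close>, on a convex ball where the derivative has norm at most
          \<open>\<epsilon>\<close>.\<close>
        have "norm ((f (x n) (\<rho> n) - D w \<rho>0 (x n)) - (f (y n) (\<rho> n) - D w \<rho>0 (y n))) \<le> \<epsilon> * norm (x n - y n)"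
        proof (rule differentiable_bound[OF convex_ball _ _ elim(1,2)])
          fix v assume v: "v \<in> ball w \<delta>"
          show "((\<lambda>u. f u (\<rho> n) - D w \<rho>0 u) has_derivative (\<lambda>h. D v (\<rho> n) h - D w \<rho>0 h)) (at v within ball w \<delta>)"
            using in_A(1)[OF v]
            by (intro has_derivative_diff has_derivative_at_withinI[OF deriv]
                bounded_linear_imp_has_derivative[OF D0])
          have "onorm (\<lambda>h. D v (\<rho> n) h - D w \<rho>0 h) \<le> Q (v, \<rho> n)"
            unfolding Q_def split_conv
            using bounded_linear.linear[OF bounded_linear_sub[OF D_bl[OF in_A(1)[OF v]] D0]]
            by (rule onorm_le_sum_Basis)
          then show "onorm (\<lambda>h. D v (\<rho> n) h - D w \<rho>0 h) \<le> \<epsilon>"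
            using in_A(2)[OF v] by simp
        qed
        also have "(f (x n) (\<rho> n) - D w \<rho>0 (x n)) - (f (y n) (\<rho> n) - D w \<rho>0 (y n)) = - D w \<rho>0 (x n - y n)"
          by (simp add: xy(2) bounded_linear.linear[OF D0] linear_diff)
        finally have "norm (D w \<rho>0 (x n - y n)) \<le> \<epsilon> * norm (x n - y n)"
          by simp
        then show ?case
          using xy(1)[of n]
          by (simp add: linear_scale[OF bounded_linear.linear[OF D0]] divide_inverse_commute[symmetric] divide_le_eq)
      qed
    qed
    then have "\<forall>\<^sub>F n in sequentially. norm (D w \<rho>0 ((x (r n) - y (r n)) /\<^sub>R norm (x (r n) - y (r n)))) \<le> \<epsilon>"
      by (rule eventually_compose_filterlim[OF _ filterlim_subseq[OF u(2)]])
    moreover have "(\<lambda>n. norm (D w \<rho>0 ((x (r n) - y (r n)) /\<^sub>R norm (x (r n) - y (r n))))) \<longlonglongrightarrow> norm (D w \<rho>0 u)"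
      by (intro tendsto_norm bounded_linear.tendsto[OF D0] u(3))
    ultimately show ?thesis
      by (intro tendsto_upperbound) auto
  qed
  then have "norm (D w \<rho>0 u) \<le> 0"
    by (rule field_le_epsilon) simp
  then show thesis
    using that u by simp
qed

section \<open>Gradient and Hessian of a parametrized function\<close>

lemma gradient_eqI:
  assumes "GDERIV f x :> D"
  shows "gradient f x = D"
  unfolding gradient_def
proof (rule the_equality)
  show "D' = D" if "GDERIV f x :> D'" for D'
  proof -
    have "(\<lambda>h. h \<bullet> D') = (\<lambda>h. h \<bullet> D)"
      using that assms unfolding gderiv_def by (rule has_derivative_unique)
    then have "(D' - D) \<bullet> (D' - D) = 0"
      by (simp add: inner_diff_right fun_eq_iff)
    then show ?thesis
      by simp
  qed
qed fact

locale parametrized_C2_function =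
  fixes \<Omega> :: "'v::euclidean_space set" and \<phi> :: "'v \<times> real \<Rightarrow> real"
  assumes open_domain: "open \<Omega>" and C2: "Ck_on 2 UNIV (\<Omega> \<times> UNIV) \<phi>"
begin

text \<open>The derivative within the domain is kept to agree with \<open>Ck_on\<close>; on this
  open set it is the ordinary one.\<close>

definition partial :: "'v \<Rightarrow> 'v \<times> real \<Rightarrow> real"
  where "partial i p = frechet_derivative \<phi> (at p within \<Omega> \<times> UNIV) (i, 0)"

lemma at_domain: "v \<in> \<Omega> \<Longrightarrow> at (v, \<rho>) within \<Omega> \<times> (UNIV :: real set) = at (v, \<rho>)"
  using open_domain by (intro at_within_open open_Times) auto

lemma has_derivative_slice:
  fixes f :: "'v \<times> real \<Rightarrow> 'b::real_normed_vector"
  assumes "f differentiable (at (v, \<rho>) within \<Omega> \<times> UNIV)" "v \<in> \<Omega>"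
  shows "((\<lambda>u. f (u, \<rho>)) has_derivative
    (\<lambda>h. frechet_derivative f (at (v, \<rho>) within \<Omega> \<times> UNIV) (h, 0))) (at v)"
proof (rule has_derivative_compose[where f = "\<lambda>u. (u, \<rho>)"])
  show "((\<lambda>u. (u, \<rho>)) has_derivative (\<lambda>h. (h, 0))) (at v)"
    by (intro has_derivative_Pair has_derivative_ident has_derivative_const)
  show "(f has_derivative frechet_derivative f (at (v, \<rho>) within \<Omega> \<times> UNIV)) (at (v, \<rho>))"
    using assms by (simp add: frechet_derivative_works at_domain)
qed

text \<open>The three levels of \<open>Ck_on 2\<close>, with the first derivative taken along
  \<open>(i, 0)\<close>.\<close>

lemma differentiable: "v \<in> \<Omega> \<Longrightarrow> \<phi> differentiable (at (v, \<rho>) within \<Omega> \<times> UNIV)"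
  and partial_differentiable: "v \<in> \<Omega> \<Longrightarrow> partial i differentiable (at (v, \<rho>) within \<Omega> \<times> UNIV)"
  and partial_continuous:
    "continuous_on (\<Omega> \<times> UNIV) (\<lambda>p. frechet_derivative (partial i) (at p within \<Omega> \<times> UNIV) h)"
  using C2 unfolding numeral_2_eq_2 Ck_on.simps partial_def[abs_def] by blast+

lemma GDERIV_grad_v:
  assumes "v \<in> \<Omega>"
  shows "GDERIV (\<lambda>u. \<phi> (u, \<rho>)) v :> (\<Sum>i\<in>Basis. partial i (v, \<rho>) *\<^sub>R i)"
proof -
  let ?D = "\<lambda>h. frechet_derivative \<phi> (at (v, \<rho>) within \<Omega> \<times> UNIV) (h, 0)"
  have D: "((\<lambda>u. \<phi> (u, \<rho>)) has_derivative ?D) (at v)"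
    by (rule has_derivative_slice[OF differentiable assms]) fact
  then have lin: "linear ?D"
    by (rule has_derivative_linear)
  have "?D h = h \<bullet> (\<Sum>i\<in>Basis. partial i (v, \<rho>) *\<^sub>R i)" for h
  proof -
    have "?D h = ?D (\<Sum>i\<in>Basis. (h \<bullet> i) *\<^sub>R i)"
      by (simp add: euclidean_representation)
    also have "\<dots> = (\<Sum>i\<in>Basis. (h \<bullet> i) *\<^sub>R ?D i)"
      by (simp only: linear_sum[OF lin] linear_scale[OF lin])
    finally show ?thesis
      by (simp add: inner_sum_right partial_def mult.commute)
  qed
  then have "?D = (\<lambda>h. h \<bullet> (\<Sum>i\<in>Basis. partial i (v, \<rho>) *\<^sub>R i))"
    by blast
  then show ?thesis
    using D by (simp only: gderiv_def)
qed

lemma grad_v_eq: "v \<in> \<Omega> \<Longrightarrow> grad_v \<phi> v \<rho> = (\<Sum>i\<in>Basis. partial i (v, \<rho>) *\<^sub>R i)"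
  unfolding grad_v_def by (rule gradient_eqI[OF GDERIV_grad_v])

lemma GDERIV_grad: "v \<in> \<Omega> \<Longrightarrow> GDERIV (\<lambda>u. \<phi> (u, \<rho>)) v :> grad_v \<phi> v \<rho>"
  using GDERIV_grad_v grad_v_eq by simp

lemma grad_v_has_derivative_sum:
  assumes "v \<in> \<Omega>"
  shows "((\<lambda>u. grad_v \<phi> u \<rho>) has_derivative
    (\<lambda>h. \<Sum>i\<in>Basis. frechet_derivative (partial i) (at (v, \<rho>) within \<Omega> \<times> UNIV) (h, 0) *\<^sub>R i)) (at v)"
proof (rule has_derivative_transform_within_open[OF _ open_domain assms])
  show "((\<lambda>u. \<Sum>i\<in>Basis. partial i (u, \<rho>) *\<^sub>R i) has_derivative
    (\<lambda>h. \<Sum>i\<in>Basis. frechet_derivative (partial i) (at (v, \<rho>) within \<Omega> \<times> UNIV) (h, 0) *\<^sub>R i)) (at v)"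
    by (intro has_derivative_sum has_derivative_scaleR_left has_derivative_slice partial_differentiable assms)
qed (simp add: grad_v_eq)

lemma hess_v_eq:
  assumes "v \<in> \<Omega>"
  shows "hess_v \<phi> v \<rho> =
    (\<lambda>h. \<Sum>i\<in>Basis. frechet_derivative (partial i) (at (v, \<rho>) within \<Omega> \<times> UNIV) (h, 0) *\<^sub>R i)"
  unfolding hess_v_def by (rule frechet_derivative_at[OF grad_v_has_derivative_sum[OF assms], symmetric])

lemma grad_v_has_derivative: "v \<in> \<Omega> \<Longrightarrow> ((\<lambda>u. grad_v \<phi> u \<rho>) has_derivative hess_v \<phi> v \<rho>) (at v)"
  using grad_v_has_derivative_sum hess_v_eq by simp

text \<open>This is the form in which \<open>kernel_of_colliding_values\<close> asks for continuity:
  jointly in point and parameter, with the direction fixed.\<close>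

lemma hess_v_continuous: "continuous_on (\<Omega> \<times> UNIV) (\<lambda>(v, \<rho>). hess_v \<phi> v \<rho> h)"
proof -
  have "continuous_on (\<Omega> \<times> UNIV)
      (\<lambda>p. \<Sum>i\<in>Basis. frechet_derivative (partial i) (at p within \<Omega> \<times> UNIV) (h, 0) *\<^sub>R i)"
    by (intro continuous_intros partial_continuous)
  then show ?thesis
    by (rule continuous_on_eq) (auto simp: hess_v_eq)
qed

text \<open>Differentiating \<open>\<phi> (T u, \<rho>) = \<phi> (u, \<rho>)\<close> at
  \<open>v\<close> shows that the gradient at \<open>T v\<close> is orthogonal to the range of
  \<open>T\<close>, which is the whole space.\<close>

lemma grad_v_invariant_zero:
  assumes T: "orthogonal_transformation T" "\<And>v. v \<in> \<Omega> \<Longrightarrow> T v \<in> \<Omega>"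
    and inv: "\<And>v. v \<in> \<Omega> \<Longrightarrow> \<phi> (T v, \<rho>) = \<phi> (v, \<rho>)"
    and v: "v \<in> \<Omega>" "grad_v \<phi> v \<rho> = 0"
  shows "grad_v \<phi> (T v) \<rho> = 0"
proof -
  have "(T has_derivative T) (at v)"
    using orthogonal_transformation_linear[OF T(1)]
    by (simp add: bounded_linear_imp_has_derivative linear_linear)
  moreover have "((\<lambda>u. \<phi> (u, \<rho>)) has_derivative (\<lambda>h. h \<bullet> grad_v \<phi> (T v) \<rho>)) (at (T v))"
    using GDERIV_grad[OF T(2)[OF v(1)]] by (simp only: gderiv_def)
  ultimately have "((\<lambda>u. \<phi> (T u, \<rho>)) has_derivative (\<lambda>h. T h \<bullet> grad_v \<phi> (T v) \<rho>)) (at v)"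
    by (rule has_derivative_compose)
  then have "((\<lambda>u. \<phi> (u, \<rho>)) has_derivative (\<lambda>h. T h \<bullet> grad_v \<phi> (T v) \<rho>)) (at v)"
    by (rule has_derivative_transform_within_open[OF _ open_domain v(1)]) (rule inv)
  moreover have "((\<lambda>u. \<phi> (u, \<rho>)) has_derivative (\<lambda>h. h \<bullet> 0)) (at v)"
    using GDERIV_grad[OF v(1), of \<rho>] by (simp only: gderiv_def v(2))
  ultimately have "(\<lambda>h. T h \<bullet> grad_v \<phi> (T v) \<rho>) = (\<lambda>h. h \<bullet> 0)"
    by (rule has_derivative_unique)
  then have zero: "T h \<bullet> grad_v \<phi> (T v) \<rho> = 0" for h
    by (auto dest: fun_cong)
  obtain h where "grad_v \<phi> (T v) \<rho> = T h"
    using surjD[OF orthogonal_transformation_surj[OF T(1)]] ..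
  then show ?thesis
    using zero[of h] by simp
qed

end

section \<open>The Hessian kernel at a bifurcation parameter\<close>

theorem theorem3p1:
  fixes G :: "('g, 'r) monoid_scheme"
    and X :: "'g topology"
    and E :: "'e::euclidean_space set"
    and A :: "('g, 'e) atlas"
    and act :: "'g \<Rightarrow> 'v::euclidean_space \<Rightarrow> 'v"
    and \<Omega> :: "'v set"
    and \<phi> :: "'v \<times> real \<Rightarrow> real"
    and w :: "real \<Rightarrow> 'v"
    and \<rho>0 :: real
  assumes "compact_lie_group G X E A"
    and "orthogonal_representation G X act"
    and "open \<Omega>"
    and "\<And>g v. g \<in> carrier G \<Longrightarrow> v \<in> \<Omega> \<Longrightarrow> act g v \<in> \<Omega>"
    and "Ck_on 2 UNIV (\<Omega> \<times> UNIV) \<phi>"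
    and "\<And>g v \<rho>. g \<in> carrier G \<Longrightarrow> v \<in> \<Omega> \<Longrightarrow> \<phi> (act g v, \<rho>) = \<phi> (v, \<rho>)"
    and "continuous_on UNIV w"
    and "\<And>\<rho>. w \<rho> \<in> \<Omega>"
    and "\<And>\<rho>. grad_v \<phi> (w \<rho>) \<rho> = 0"
    and "\<rho>0 \<in> BIF G act \<Omega> \<phi> w"
  shows "dim {h. hess_v \<phi> (w \<rho>0) \<rho>0 h = 0} > manifold_dim (orbit G act (w \<rho>0))"
proof -
  interpret G: compact_lie_group G X E A
    by fact
  interpret R: orthogonal_representation G X act
    by fact
  interpret \<phi>: parametrized_C2_function \<Omega> \<phi>
    by unfold_locales fact+
  define K where "K = (\<lambda>g. endo_of (act g)) ` carrier G"
  have eapp_act: "eapp (endo_of (act g)) = act g" if "g \<in> carrier G" for g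
    by (rule eapp_endo_of[OF bounded_linear_orthogonal_transformation[OF R.orthogonal[OF that]]])
  have act_mult: "act (g \<otimes>\<^bsub>G\<^esub> h) v = act g (act h v)" if "g \<in> carrier G" "h \<in> carrier G" for g h v
    using R.composition_rule[OF UNIV_I that] .
  have act_one: "act \<one>\<^bsub>G\<^esub> v = v" for v
    using fun_cong[OF R.id_eq_one, of v] by simp
  have endo_mult: "endo_of (act g) * endo_of (act h) = endo_of (act (g \<otimes>\<^bsub>G\<^esub> h))"
    if "g \<in> carrier G" "h \<in> carrier G" for g h
    using that by (intro eapp_eqI) (simp add: eapp_act act_mult)
  have endo_one: "endo_of (act \<one>\<^bsub>G\<^esub>) = 1"
    by (intro eapp_eqI) (simp add: eapp_act act_one)
  have "compact K"
  proof -
    have "continuous_map X euclidean (\<lambda>g. endo_of (act g))"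
    proof (rule continuous_map_endo_of)
      show "bounded_linear (act g)" if "g \<in> topspace X" for g
        using that R.orthogonal G.topspace_carrier by (simp add: bounded_linear_orthogonal_transformation)
      show "continuous_map X euclidean (\<lambda>g. act g v)" for v
      proof -
        have "continuous_map X (prod_topology X euclidean) (\<lambda>g. (g, v))"
          by (intro continuous_map_pairedI) auto
        from continuous_map_compose[OF this R.continuous] show ?thesis
          by (simp add: o_def)
      qed
    qed
    then have "compactin euclidean ((\<lambda>g. endo_of (act g)) ` topspace X)"
      using G.compact unfolding compact_space_def by (intro image_compactin)
    then show ?thesis
      by (simp add: K_def G.topspace_carrier)
  qed
  interpret K: compact_isometry_group K
  proof
    show "compact K" by fact
    show "1 \<in> K"
      unfolding K_def using endo_one[symmetric] G.one_closed by (rule image_eqI)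
    show "a * b \<in> K" if "a \<in> K" "b \<in> K" for a b
      using that by (auto simp: K_def endo_mult)
    show "\<exists>b\<in>K. a * b = 1 \<and> b * a = 1" if a: "a \<in> K" for a
    proof -
      obtain g where g: "g \<in> carrier G" "a = endo_of (act g)"
        using a by (auto simp: K_def)
      then show ?thesis
        by (intro bexI[of _ "endo_of (act (inv\<^bsub>G\<^esub> g))"]) (simp_all add: K_def endo_mult endo_one)
    qed
    show "norm (eapp a v) = norm v" if "a \<in> K" for a v
      using that R.orthogonal by (auto simp: K_def eapp_act orthogonal_transformation)
  qed
  have orbit_eq: "orbit G act v = K.orb v" for v
    unfolding orbit_def K.orb_def by (auto simp: K_def eapp_act image_image)
  have zero_K: "grad_v \<phi> (eapp k v) \<rho> = 0" if k: "k \<in> K" and "v \<in> \<Omega>" "grad_v \<phi> v \<rho> = 0" for k v \<rho>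
  proof -
    obtain g where g: "g \<in> carrier G" "k = endo_of (act g)"
      using k by (auto simp: K_def)
    have "grad_v \<phi> (act g v) \<rho> = 0"
      by (rule \<phi>.grad_v_invariant_zero[OF R.orthogonal[OF g(1)] assms(4)[OF g(1)] assms(6)[OF g(1)] that(2,3)])
    then show ?thesis
      by (simp add: g eapp_act)
  qed
  let ?w0 = "w \<rho>0"
  let ?H = "hess_v \<phi> ?w0 \<rho>0"
  note H_deriv = \<phi>.grad_v_has_derivative[OF assms(8)[of \<rho>0], of \<rho>0]
  have kernel: "subspace {h. ?H h = 0}"
    using has_derivative_linear[OF H_deriv] by (rule linear_subspace_kernel)
  \<comment> \<open>By invariance the gradient vanishes on the whole orbit, so its derivative kills
    tangent directions.\<close>
  have "K.tangent ?w0 \<subseteq> {h. ?H h = 0}"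
  proof
    fix u assume u: "u \<in> K.tangent ?w0"
    have "grad_v \<phi> x \<rho>0 = 0" if "x \<in> K.orb ?w0" for x
      using that zero_K[OF _ assms(8,9)] by (auto simp: K.orb_def)
    from K.tangent_in_kernel[OF this H_deriv u] show "u \<in> {h. ?H h = 0}"
      by simp
  qed
  define Z where "Z = {(v, \<rho>). (v, \<rho>) \<in> \<Omega> \<times> UNIV - trivial_family G act w \<and> grad_v \<phi> v \<rho> = 0}"
  have "(?w0, \<rho>0) islimpt Z"
    using assms(10) by (simp add: BIF_def Z_def)
  then obtain z :: "nat \<Rightarrow> 'v \<times> real" where z: "\<forall>n. z n \<in> Z - {(?w0, \<rho>0)}" and z_lim: "z \<longlonglongrightarrow> (?w0, \<rho>0)"
    unfolding islimpt_sequential by (elim exE conjE)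
  define v where "v n = fst (z n)" for n
  define \<rho> where "\<rho> n = snd (z n)" for n
  have v: "v n \<in> \<Omega>" "(v n, \<rho> n) \<notin> trivial_family G act w" "grad_v \<phi> (v n) (\<rho> n) = 0" for n
    using z[rule_format, of n] by (auto simp: Z_def v_def \<rho>_def split_def)
  have v_lim: "v \<longlonglongrightarrow> ?w0" and \<rho>_lim: "\<rho> \<longlonglongrightarrow> \<rho>0"
    using tendsto_fst[OF z_lim] tendsto_snd[OF z_lim] by (simp_all add: v_def[abs_def] \<rho>_def[abs_def])
  have w_lim: "(\<lambda>n. w (\<rho> n)) \<longlonglongrightarrow> ?w0"
    using assms(7) \<rho>_lim by (rule continuous_on_tendsto_compose) auto
  have slice: "\<exists>k. k \<in> K \<and> norm (eapp k x - ?w0) \<le> norm (x - ?w0) \<and>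
      (\<forall>u\<in>K.tangent ?w0. (eapp k x - ?w0) \<bullet> u = 0)" for x
    by (rule K.move_to_slice[of x ?w0]) blast
  \<comment> \<open>Moving into the slice does not increase the distance to \<open>?w0\<close>, so
    the moved sequences still converge to it.\<close>
  have slice_lim: "(\<lambda>n. eapp (k n) (x n)) \<longlonglongrightarrow> ?w0"
    if "x \<longlonglongrightarrow> ?w0" "\<And>n. norm (eapp (k n) (x n) - ?w0) \<le> norm (x n - ?w0)" for x k
    by (rule LIM_zero_cancel, rule Lim_null_comparison[OF always_eventually tendsto_norm_zero[OF LIM_zero[OF that(1)]]])
      (simp add: that(2))
  obtain k where k: "\<And>n. k n \<in> K" "\<And>n. norm (eapp (k n) (v n) - ?w0) \<le> norm (v n - ?w0)"
      "\<And>n u. u \<in> K.tangent ?w0 \<Longrightarrow> (eapp (k n) (v n) - ?w0) \<bullet> u = 0"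
    using choice[OF allI[OF slice], of v] by blast
  \<comment> \<open>The points \<open>w (\<rho> n)\<close> are moved as well, since they need not
    lie in the normal slice at \<open>?w0\<close>.\<close>
  obtain l where l: "\<And>n. l n \<in> K" "\<And>n. norm (eapp (l n) (w (\<rho> n)) - ?w0) \<le> norm (w (\<rho> n) - ?w0)"
      "\<And>n u. u \<in> K.tangent ?w0 \<Longrightarrow> (eapp (l n) (w (\<rho> n)) - ?w0) \<bullet> u = 0"
    using choice[OF allI[OF slice], of "\<lambda>n. w (\<rho> n)"] by blast
  let ?x = "\<lambda>n. eapp (k n) (v n)" and ?y = "\<lambda>n. eapp (l n) (w (\<rho> n))"
  \<comment> \<open>Otherwise \<open>v n\<close> would lie in the orbit of
    \<open>w (\<rho> n)\<close>, against its choice outside the trivial family.\<close>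
  have ne: "?x n \<noteq> ?y n" for n
  proof
    assume eq: "?x n = ?y n"
    obtain b where b: "b \<in> K" "b * k n = 1"
      using K.inverse[OF k(1)] by blast
    have "v n = eapp b (?y n)"
      using arg_cong[OF b(2), of "\<lambda>a. eapp a (v n)"] eq by simp
    also have "\<dots> \<in> K.orb (w (\<rho> n))"
      by (intro K.eapp_orb b(1) l(1) K.orb_refl)
    finally show False
      using v(2)[of n] by (simp add: trivial_family_def orbit_eq)
  qed
  have zeros: "grad_v \<phi> (?x n) (\<rho> n) = grad_v \<phi> (?y n) (\<rho> n)" for n
    using zero_K[OF k(1) v(1,3)] zero_K[OF l(1) assms(8,9)] by simp
  obtain u r where u: "norm u = 1" "strict_mono r"
      "(\<lambda>n. (?x (r n) - ?y (r n)) /\<^sub>R norm (?x (r n) - ?y (r n))) \<longlonglongrightarrow> u" "?H u = 0"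
    by (rule kernel_of_colliding_values[OF assms(3) assms(8) \<phi>.grad_v_has_derivative \<phi>.hess_v_continuous
        slice_lim[OF v_lim k(2)] slice_lim[OF w_lim l(2)] \<rho>_lim ne zeros])
  \<comment> \<open>The normalized differences are orthogonal to every tangent vector. A tangent
    \<open>u\<close> would then be orthogonal to itself in the limit, but it has norm 1.\<close>
  have "u \<notin> K.tangent ?w0"
  proof
    assume "u \<in> K.tangent ?w0"
    then have "(?x (r n) - ?y (r n)) \<bullet> u = 0" for n
      using k(3)[of u "r n"] l(3)[of u "r n"] by (simp add: inner_diff_left)
    then have "((?x (r n) - ?y (r n)) /\<^sub>R norm (?x (r n) - ?y (r n))) \<bullet> u = 0" for n
      by simp
    moreover have "(\<lambda>n. ((?x (r n) - ?y (r n)) /\<^sub>R norm (?x (r n) - ?y (r n))) \<bullet> u) \<longlonglongrightarrow> u \<bullet> u"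
      by (intro tendsto_intros u(3))
    ultimately have "u \<bullet> u = 0"
      by (simp only: LIMSEQ_const_iff)
    then show False
      using u(1) by simp
  qed
  \<comment> \<open>Both sets are subspaces and equal their spans, so the strict inclusion passes to
    dimensions.\<close>
  then have "span (K.tangent ?w0) \<subset> span {h. ?H h = 0}"
    using \<open>K.tangent ?w0 \<subseteq> {h. ?H h = 0}\<close> u(4) kernel K.subspace_tangent[of ?w0]
    by (simp add: span_eq_iff[THEN iffD2] psubset_eq) blast
  then show ?thesis
    by (simp only: orbit_eq K.manifold_dim_orb dim_psubset)
qed

end
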